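(* Let $B$ be a bounded subset of $X$. There exists an integer $N\ge1$ such that for every $\psi\in B$, the entire function $\chi_P(\cdot,\psi)=\Delta^2(\cdot,\psi)-4$ has exactly two roots in each of the two discs $D^i_n$, $i=1,2$, for all $n\in\mathbb{Z}$ with $|n|>N$, and exactly $4(2N+1)$ roots in the disc $B_N$, when counted with multiplicity. There are no other roots.
   Context: $X=H^1(\mathbb{T},\mathbb{C})^4$, $\mathbb{T}=\mathbb{R}/\mathbb{Z}$, with its Hilbert norm; $\psi=(\psi^1,\dots,\psi^4)\in X$. Let $\sigma_3=\mathrm{diag}(1,-1)$ and $V=\begin{pmatrix}-i\psi^1\psi^2 & 2\lambda\psi^1+i\psi^3\\ 2\lambda\psi^2-i\psi^4 & i\psi^1\psi^2\end{pmatrix}$. $M(t,\lambda,\psi)$ is the unique matrix solution of $\partial_tM=(-2i\lambda^2\sigma_3+V)M$, $M(0)=I$. The discriminant is $\Delta(\lambda,\psi)=\operatorname{tr}M(1,\lambda,\psi)$. Discs: for $m\in\mathbb{Z}\setminus\{0\}$ let $U_m=\{\lambda\in\mathbb{C}:|2\lambda^2-m\pi|<\pi/4\}$. For $n\ge1$: $D^1_n=U_n\cap\{\operatorname{Re}\lambda>0\}$, $D^1_{-n}=U_n\cap\{\operatorname{Re}\lambda<0\}$, $D^2_n=U_{-n}\cap\{\operatorname{Im}\lambda>0\}$, $D^2_{-n}=U_{-n}\cap\{\operatorname{Im}\lambda<0\}$. For $N\ge1$, $B_N=\{|\lambda|<\sqrt{(N+1/4)\pi/2}\}$. *)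

theory Defs
  imports "HOL-Complex_Analysis.Complex_Analysis"
begin

section \<open>The phase space\<close>

text \<open>
  Functions on the circle \<open>\<real>/\<int>\<close> are 1-periodic functions on \<open>\<real>\<close>. An element of
  \<open>H\<^sup>1\<close> is identified with its absolutely continuous representative, i.e. with an indefinite
  integral of a square-integrable function.
\<close>

definition L2_deriv :: "(real \<Rightarrow> complex) \<Rightarrow> (real \<Rightarrow> complex) \<Rightarrow> bool" where
  "L2_deriv f g \<longleftrightarrow>
     g \<in> borel_measurable (lebesgue_on {0..1}) \<and>
     integrable (lebesgue_on {0..1}) (\<lambda>t. (cmod (g t))\<^sup>2) \<and>
     (\<forall>t\<in>{0..1}. (g has_integral (f t - f 0)) {0..t})"

definition H1_circle :: "(real \<Rightarrow> complex) set" where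
  "H1_circle = {f. (\<forall>t. f (t + 1) = f t) \<and> (\<exists>g. L2_deriv f g)}"

text \<open>
  Any two functions \<open>g\<close> with \<open>L2_deriv f g\<close> agree almost everywhere on \<open>[0,1]\<close>, so the
  choice made here does not affect the norm, which is
  \<open>(\<integral>\<^sub>0\<^sup>1 \<bar>f\<bar>\<^sup>2 + \<bar>f'\<bar>\<^sup>2)\<^sup>1\<^sup>/\<^sup>2\<close>.
\<close>

definition H1_norm :: "(real \<Rightarrow> complex) \<Rightarrow> real" where
  "H1_norm f = sqrt (integral\<^sup>L (lebesgue_on {0..1}) (\<lambda>t. (cmod (f t))\<^sup>2)
                   + integral\<^sup>L (lebesgue_on {0..1}) (\<lambda>t. (cmod ((SOME g. L2_deriv f g) t))\<^sup>2))"

definition X_space :: "((real \<Rightarrow> complex) ^ 4) set" where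
  "X_space = {\<psi>. \<forall>j. \<psi> $ j \<in> H1_circle}"

definition X_norm :: "(real \<Rightarrow> complex) ^ 4 \<Rightarrow> real" where
  "X_norm \<psi> = sqrt (\<Sum>j\<in>UNIV. (H1_norm (\<psi> $ j))\<^sup>2)"

definition X_bounded :: "((real \<Rightarrow> complex) ^ 4) set \<Rightarrow> bool" where
  "X_bounded B \<longleftrightarrow> B \<subseteq> X_space \<and> (\<exists>R. \<forall>\<psi>\<in>B. X_norm \<psi> \<le> R)"


section \<open>Fundamental solution and discriminant\<close>

text \<open>The spectral parameter is written \<open>z\<close>, since \<open>\<lambda>\<close> is reserved for abstraction.\<close>

definition sigma3 :: "complex ^ 2 ^ 2" where
  "sigma3 = vector [vector [1, 0], vector [0, -1]]"

definition V_mat :: "complex \<Rightarrow> (real \<Rightarrow> complex) ^ 4 \<Rightarrow> real \<Rightarrow> complex ^ 2 ^ 2" where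
  "V_mat z \<psi> t = vector
     [vector [- \<i> * (\<psi> $ 1) t * (\<psi> $ 2) t,      2 * z * (\<psi> $ 1) t + \<i> * (\<psi> $ 3) t],
      vector [2 * z * (\<psi> $ 2) t - \<i> * (\<psi> $ 4) t,  \<i> * (\<psi> $ 1) t * (\<psi> $ 2) t]]"

text \<open>\<open>mat c ** A\<close> is the product of the matrix \<open>A\<close> with the complex scalar \<open>c\<close>.\<close>

definition is_fundamental_solution ::
    "complex \<Rightarrow> (real \<Rightarrow> complex) ^ 4 \<Rightarrow> (real \<Rightarrow> complex ^ 2 ^ 2) \<Rightarrow> bool" where
  "is_fundamental_solution z \<psi> M \<longleftrightarrow>
     M 0 = mat 1 \<and>
     (\<forall>t. (M has_vector_derivative
             ((mat (- 2 * \<i> * z\<^sup>2) ** sigma3 + V_mat z \<psi> t) ** M t)) (at t))"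

definition fundamental_solution ::
    "real \<Rightarrow> complex \<Rightarrow> (real \<Rightarrow> complex) ^ 4 \<Rightarrow> complex ^ 2 ^ 2" where
  "fundamental_solution t z \<psi> = (THE M. is_fundamental_solution z \<psi> M) t"

definition discriminant :: "complex \<Rightarrow> (real \<Rightarrow> complex) ^ 4 \<Rightarrow> complex" where
  "discriminant z \<psi> = trace (fundamental_solution 1 z \<psi>)"

definition chi_P :: "complex \<Rightarrow> (real \<Rightarrow> complex) ^ 4 \<Rightarrow> complex" where
  "chi_P z \<psi> = (discriminant z \<psi>)\<^sup>2 - 4"


section \<open>Discs\<close>

definition U_set :: "int \<Rightarrow> complex set" where
  "U_set m = {z. cmod (2 * z\<^sup>2 - of_real (of_int m * pi)) < pi / 4}"

text \<open>The index \<open>n\<close> is meant to be nonzero; its sign selects the component.\<close>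

definition disc1 :: "int \<Rightarrow> complex set" where
  "disc1 n = U_set \<bar>n\<bar> \<inter> (if n > 0 then {z. Re z > 0} else {z. Re z < 0})"

definition disc2 :: "int \<Rightarrow> complex set" where
  "disc2 n = U_set (- \<bar>n\<bar>) \<inter> (if n > 0 then {z. Im z > 0} else {z. Im z < 0})"

definition B_disc :: "nat \<Rightarrow> complex set" where
  "B_disc N = {z. cmod z < sqrt ((real N + 1 / 4) * pi / 2)}"


section \<open>Counting roots with multiplicity\<close>

text \<open>
  For an analytic function that does not vanish identically near a root \<open>z\<close>, \<open>zorder f z\<close> is
  the multiplicity of \<open>z\<close>. On an open set, finiteness of the set of roots excludes identical
  vanishing.
\<close>

definition has_root_count :: "(complex \<Rightarrow> complex) \<Rightarrow> complex set \<Rightarrow> nat \<Rightarrow> bool" where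
  "has_root_count f S k \<longleftrightarrow>
     finite {z \<in> S. f z = 0} \<and> (\<Sum>z | z \<in> S \<and> f z = 0. zorder f z) = int k"

end

theory Submission
  imports Defs
begin

text \<open>
  The characteristic function \<^term>\<open>chi_P z \<psi>\<close> is a small perturbation, for large \<open>z\<close>, of the
  one for \<open>\<psi> = 0\<close>, which is \<open>4 cos\<^sup>2 (2z\<^sup>2) - 4 = - 4 sin\<^sup>2 (2z\<^sup>2)\<close>. The latter has a root of
  order four at the origin and double roots at the other points with \<open>2z\<^sup>2 \<in> \<pi>\<int>\<close>, four of them for
  each pair \<open>\<plusminus>m\<close>. The theorem of Rouche transfers these numbers, uniformly in \<open>\<psi>\<close>,
  once the perturbation is dominated off small neighbourhoods of the unperturbed roots.

  The estimate is not immediate, because the off-diagonal part of the potential grows like \<open>z\<close>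
  while the spectral gap is of size \<open>z\<^sup>2\<close>: at second order, the two off-diagonal entries
  contribute \<open>(2z \<psi>\<^sup>1) (2z \<psi>\<^sup>2) / (- 4\<i> z\<^sup>2) = \<i> \<psi>\<^sup>1 \<psi>\<^sup>2\<close>, which does not decay.
  The diagonal entry \<open>- \<i> \<psi>\<^sup>1 \<psi>\<^sup>2\<close> cancels exactly this term. To make the cancellation visible,
  a column \<open>(a, c)\<close> of the fundamental solution is replaced by \<open>(a + p c, c + r a)\<close> with functions
  \<open>p\<close> and \<open>r\<close> of size \<open>1/z\<close> that remove the off-diagonal part (\<open>gauge_identity\<close>). This requires
  differentiating \<open>p\<close> and \<open>r\<close>, hence the potential, whose derivative exists only almost everywhere.
  So \<open>p\<close> and \<open>r\<close> are built from averages of the potential over intervals of length \<open>\<bar>z\<bar>\<^sup>-\<^sup>2\<close>.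
  Averaging costs an error \<open>z\<close> times the difference between potential and average, and a derivative
  divided by \<open>z\<close>; both have integrals of size \<open>1/\<bar>z\<bar>\<close>, because functions in \<open>H\<^sup>1\<close> have bounded
  variation (\<open>steklov_average\<close>, \<open>modulus_increment_primitive\<close>).
  The transformed system is diagonal up to an integrable error of size \<open>1/\<bar>z\<bar>\<close>, and an energy estimate
  gives \<open>column_asymptotics\<close> and \<open>discriminant_asymptotics\<close>: the discriminant differs from
  \<open>2 cos (2z\<^sup>2)\<close> by at most a constant times \<open>exp \<bar>Im (2z\<^sup>2)\<bar> / \<bar>z\<bar>\<close>, where the constant depends only
  on a bound for the norm of \<open>\<psi>\<close>.

  On the other side, \<open>\<bar>sin w\<bar>\<close> is at least a constant times \<open>exp \<bar>Im w\<bar>\<close> when \<open>w\<close> keeps a fixed distance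
  from \<open>\<pi>\<int>\<close> (\<open>norm_sin_lower_bound\<close>). Hence, for large \<open>z\<close>, the perturbation is dominated and
  there are no roots unless \<open>2z\<^sup>2\<close> is close to some \<open>m\<pi>\<close>. The regions in the statement are not round, but
  this makes it possible to count on circles that lie inside them (\<open>root_localisation\<close>).

  Existence and uniqueness of the fundamental solution, and its holomorphic dependence on \<open>z\<close>,
  come from the Picard series: each of its terms is a polynomial in \<open>z\<close>, and the series converges
  locally uniformly.
\<close>

text \<open>The dollar sign is reserved for the components of vectors and matrices.\<close>

unbundle no fps_syntax


section \<open>Linear differential equations and Picard series\<close>

text \<open>
  The lower limit is 0 also for negative arguments: the differential equation is
  posed on the whole line.
\<close>

definition primitive :: "(real \<Rightarrow> 'a::euclidean_space) \<Rightarrow> real \<Rightarrow> 'a" where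
  "primitive f t = (LBINT s=0..t. f s)"

lemma primitive_0 [simp]: "primitive f 0 = 0"
  by (simp add: primitive_def zero_ereal_def[symmetric])

lemma primitive_has_vector_derivative:
  assumes "continuous_on UNIV f"
  shows "(primitive f has_vector_derivative f t) (at t)"
proof -
  have "((\<lambda>u. LBINT y=0..u. f y) has_vector_derivative f t) (at t within {-\<bar>t\<bar>-1..\<bar>t\<bar>+1})"
    unfolding zero_ereal_def
    by (rule interval_integral_FTC2) (use assms in \<open>auto intro: continuous_on_subset\<close>)
  moreover have "at t within {-\<bar>t\<bar>-1..\<bar>t\<bar>+1} = at t"
    by (rule at_within_Icc_at) auto
  ultimately show ?thesis
    by (simp add: primitive_def[abs_def])
qed

lemma continuous_on_primitive:
  assumes "continuous_on UNIV f"
  shows "continuous_on UNIV (primitive f)"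
  using primitive_has_vector_derivative[OF assms]
  by (meson continuous_at_imp_continuous_on has_vector_derivative_continuous)

lemma primitive_unique:
  assumes "continuous_on UNIV f" and "F 0 = 0" and "\<And>t. (F has_vector_derivative f t) (at t)"
  shows "F = primitive f"
proof -
  have "((\<lambda>t. F t - primitive f t) has_vector_derivative 0) (at t)" for t
    using has_vector_derivative_diff[OF assms(3) primitive_has_vector_derivative[OF assms(1)], of t]
    by simp
  then obtain c where c: "\<And>t. F t - primitive f t = c"
    using has_vector_derivative_zero_constant[of UNIV "\<lambda>t. F t - primitive f t"] by auto
  have "c = 0" using c[of 0] assms(2) by simp
  then show ?thesis using c by auto
qed

text \<open>
  In the weighted norm \<open>sup \<bar>f t\<bar> exp (- 2 L \<bar>t\<bar>)\<close>, integrating a function of size \<open>L\<close> times a given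
  one gains a factor 1/2, because \<open>2 L\<close> times the integral of \<open>exp (2 L \<bar>s\<bar>)\<close> from 0 to \<open>t\<close> is at most \<open>exp (2 L \<bar>t\<bar>)\<close>.
  This makes Picard iteration a contraction on every bounded interval.
\<close>

lemma norm_le_exp_step:
  fixes f :: "real \<Rightarrow> 'a::real_normed_vector"
  assumes "L > 0" "c \<ge> 0" "f 0 = 0"
    and deriv: "\<And>s. \<bar>s\<bar> \<le> T \<Longrightarrow> (f has_vector_derivative f' s) (at s)"
    and bound: "\<And>s. \<bar>s\<bar> \<le> T \<Longrightarrow> norm (f' s) \<le> L * (c * exp (2 * L * \<bar>s\<bar>))"
    and "\<bar>t\<bar> \<le> T"
  shows "norm (f t) \<le> c / 2 * exp (2 * L * \<bar>t\<bar>)"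
proof (cases "t = 0")
  case False
  \<comment> \<open>Reflection reduces negative times to positive ones.\<close>
  define \<sigma> where "\<sigma> = sgn t"
  have \<sigma>: "\<bar>\<sigma>\<bar> = 1" "t = \<sigma> * \<bar>t\<bar>"
    using False by (auto simp: \<sigma>_def sgn_if)
  have *: "((\<lambda>s. f (\<sigma> * s)) has_vector_derivative \<sigma> *\<^sub>R f' (\<sigma> * s)) (at s)"
    if "0 \<le> s" "s \<le> \<bar>t\<bar>" for s
  proof -
    have "\<bar>\<sigma> * s\<bar> \<le> T" using that \<sigma> assms(6) by (simp add: abs_mult)
    then have "(f \<circ> (\<lambda>s. \<sigma> * s) has_vector_derivative \<sigma> *\<^sub>R f' (\<sigma> * s)) (at s)"
      by (intro vector_diff_chain_at deriv) (auto intro!: derivative_eq_intros)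
    then show ?thesis by (simp add: o_def)
  qed
  have "norm (f (\<sigma> * \<bar>t\<bar>) - f (\<sigma> * 0)) \<le>
          c / 2 * exp (2 * L * \<bar>t\<bar>) - c / 2 * exp (2 * L * 0)"
  proof (rule differentiable_bound_general)
    show "0 < \<bar>t\<bar>" using False by simp
    show "continuous_on {0..\<bar>t\<bar>} (\<lambda>s. f (\<sigma> * s))"
      using * by (meson atLeastAtMost_iff continuous_at_imp_continuous_on has_vector_derivative_continuous)
    show "continuous_on {0..\<bar>t\<bar>} (\<lambda>s. c / 2 * exp (2 * L * s))"
      by (intro continuous_intros)
    show "((\<lambda>s. c / 2 * exp (2 * L * s)) has_vector_derivative c * L * exp (2 * L * s)) (at s)" for s
      unfolding has_real_derivative_iff_has_vector_derivative[symmetric]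
      by (auto intro!: derivative_eq_intros)
    show "((\<lambda>s. f (\<sigma> * s)) has_vector_derivative \<sigma> *\<^sub>R f' (\<sigma> * s)) (at s)"
      if "0 < s" "s < \<bar>t\<bar>" for s
      using * that by simp
    show "norm (\<sigma> *\<^sub>R f' (\<sigma> * s)) \<le> c * L * exp (2 * L * s)" if "0 < s" "s < \<bar>t\<bar>" for s
      using bound[of "\<sigma> * s"] \<sigma>(1) that assms(6) by (simp add: abs_mult mult_ac)
  qed
  then show ?thesis using \<sigma>(2) assms(2,3) by simp
qed (use assms in auto)

lemma has_vector_derivative_series:
  fixes f :: "nat \<Rightarrow> real \<Rightarrow> 'a::banach"
  assumes "convex S"
    and der: "\<And>n x. x \<in> S \<Longrightarrow> (f n has_vector_derivative f' n x) (at x within S)"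
    and lim: "uniform_limit S (\<lambda>n x. \<Sum>i<n. f' i x) g' sequentially"
    and "x0 \<in> S" "summable (\<lambda>n. f n x0)"
  shows "\<exists>g. \<forall>x\<in>S. (\<lambda>n. f n x) sums g x \<and> (g has_vector_derivative g' x) (at x within S)"
  unfolding has_vector_derivative_def
proof (rule has_derivative_series)
  show "(\<lambda>n. f n x0) sums (\<Sum>n. f n x0)"
    using assms(5) by (rule summable_sums)
  show "\<And>n x. x \<in> S \<Longrightarrow> (f n has_derivative (\<lambda>h. h *\<^sub>R f' n x)) (at x within S)"
    using der by (simp add: has_vector_derivative_def)
  show "\<forall>\<^sub>F n in sequentially. \<forall>x\<in>S. \<forall>h. norm ((\<Sum>i<n. h *\<^sub>R f' i x) - h *\<^sub>R g' x) \<le> e * norm h"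
    if "e > 0" for e :: real
    using uniform_limitD[OF lim that]
  proof eventually_elim
    case (elim n)
    show ?case
    proof (intro ballI allI)
      fix x and h :: real assume "x \<in> S"
      then have "norm ((\<Sum>i<n. f' i x) - g' x) \<le> e"
        using elim by (auto simp: dist_norm less_imp_le)
      then have "\<bar>h\<bar> * norm ((\<Sum>i<n. f' i x) - g' x) \<le> \<bar>h\<bar> * e"
        by (intro mult_left_mono) auto
      then show "norm ((\<Sum>i<n. h *\<^sub>R f' i x) - h *\<^sub>R g' x) \<le> e * norm h"
        by (simp add: scaleR_sum_right[symmetric] scaleR_diff_right[symmetric] mult.commute)
    qed
  qed
qed (use assms in auto)

text \<open>
  The terms of the series solution of \<open>y' = A y\<close>, \<open>y 0 = y0\<close>. The product \<open>pr\<close> is kept abstract,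
  since only its bilinearity and boundedness matter.
\<close>

primrec picard_term :: "('b \<Rightarrow> 'a \<Rightarrow> 'a::euclidean_space) \<Rightarrow> (real \<Rightarrow> 'b) \<Rightarrow> 'a \<Rightarrow> nat \<Rightarrow> real \<Rightarrow> 'a" where
  "picard_term pr A y0 0 = (\<lambda>t. y0)"
| "picard_term pr A y0 (Suc n) = primitive (\<lambda>t. pr (A t) (picard_term pr A y0 n t))"

context bounded_bilinear
begin

lemma linear_bound_on_compact:
  fixes A :: "real \<Rightarrow> 'a"
  assumes "continuous_on UNIV A"
  obtains L where "L > 0" "\<And>t y. \<bar>t\<bar> \<le> T \<Longrightarrow> norm (prod (A t) y) \<le> L * norm y"
proof -
  have "compact (A ` {-T..T})"
    using assms by (intro compact_continuous_image) (auto intro: continuous_on_subset)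
  then obtain R where R: "R > 0" "\<And>t. \<bar>t\<bar> \<le> T \<Longrightarrow> norm (A t) \<le> R"
    using compact_imp_bounded[of "A ` {-T..T}"] unfolding bounded_pos by (auto simp: abs_le_iff)
  obtain K where K: "K > 0" "\<And>a b. norm (prod a b) \<le> norm a * norm b * K"
    using pos_bounded by blast
  show ?thesis
  proof
    show "R * K > 0" using R K by simp
    fix t and y :: 'b assume "\<bar>t\<bar> \<le> T"
    then have "norm (A t) * norm y * K \<le> R * norm y * K"
      using R K by (intro mult_right_mono) auto
    then show "norm (prod (A t) y) \<le> R * K * norm y"
      using K(2)[of "A t" y] by (simp add: mult_ac)
  qed
qed

end

text \<open>
  The difference \<open>d\<close> of two solutions is bounded on a compact interval, and \<open>norm_le_exp_step\<close>
  halves the bound again and again.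
\<close>

lemma linear_ode_unique:
  fixes y1 y2 :: "real \<Rightarrow> 'a::real_normed_vector"
  assumes "bounded_bilinear pr" and "continuous_on UNIV A"
    and "\<And>t. (y1 has_vector_derivative pr (A t) (y1 t)) (at t)"
    and "\<And>t. (y2 has_vector_derivative pr (A t) (y2 t)) (at t)"
    and "y1 0 = y2 0"
  shows "y1 = y2"
proof
  fix t :: real
  interpret bounded_bilinear pr by fact
  define T where "T = \<bar>t\<bar>"
  define d where "d = (\<lambda>t. y1 t - y2 t)"
  have d: "(d has_vector_derivative pr (A s) (d s)) (at s)" for s
    using has_vector_derivative_diff[OF assms(3,4), of s] by (simp add: d_def diff_right)
  obtain L where L: "L > 0" "\<And>s y. \<bar>s\<bar> \<le> T \<Longrightarrow> norm (pr (A s) y) \<le> L * norm y"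
    using linear_bound_on_compact[OF assms(2)] by metis
  have "continuous_on {-T..T} d"
    using d by (meson continuous_at_imp_continuous_on has_vector_derivative_continuous)
  then have "compact (d ` {-T..T})" by (intro compact_continuous_image) auto
  then obtain c where c: "c > 0" "\<And>s. \<bar>s\<bar> \<le> T \<Longrightarrow> norm (d s) \<le> c"
    using compact_imp_bounded[of "d ` {-T..T}"] unfolding bounded_pos by (auto simp: abs_le_iff)
  have bound: "\<bar>s\<bar> \<le> T \<Longrightarrow> norm (d s) \<le> c * (1/2) ^ n * exp (2 * L * \<bar>s\<bar>)" for n s
  proof (induction n arbitrary: s)
    case 0
    have "c * 1 \<le> c * exp (2 * L * \<bar>s\<bar>)" using c L by (intro mult_left_mono) auto
    then show ?case using c(2)[OF 0] by simp
  next
    case (Suc n)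
    have "norm (d s) \<le> (c * (1/2) ^ n) / 2 * exp (2 * L * \<bar>s\<bar>)"
    proof (rule norm_le_exp_step[where f' = "\<lambda>s. pr (A s) (d s)"])
      show "norm (pr (A u) (d u)) \<le> L * (c * (1/2) ^ n * exp (2 * L * \<bar>u\<bar>))" if "\<bar>u\<bar> \<le> T" for u
        using L(2)[OF that, of "d u"] Suc.IH[OF that] L(1)
        by (meson mult_left_mono less_imp_le order_trans)
    qed (use L c d assms Suc.prems in \<open>auto simp: d_def\<close>)
    then show ?case by simp
  qed
  have "(\<lambda>n. c * (1/2) ^ n * exp (2 * L * \<bar>t\<bar>)) \<longlonglongrightarrow> c * 0 * exp (2 * L * \<bar>t\<bar>)"
    by (intro tendsto_intros LIMSEQ_realpow_zero) auto
  moreover have "norm (d t) \<le> c * (1/2) ^ n * exp (2 * L * \<bar>t\<bar>)" for n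
    using bound[of t] by (simp add: T_def)
  ultimately have "norm (d t) \<le> c * 0 * exp (2 * L * \<bar>t\<bar>)"
    by (intro LIMSEQ_le_const) blast+
  then show "y1 t = y2 t" by (simp add: d_def)
qed

lemma
  assumes "bounded_bilinear pr" and "continuous_on UNIV A"
  shows continuous_on_picard_term: "continuous_on UNIV (picard_term pr A y0 n)"
    and picard_term_has_vector_derivative:
      "(picard_term pr A y0 (Suc n) has_vector_derivative pr (A t) (picard_term pr A y0 n t)) (at t)"
proof -
  have *: "continuous_on UNIV (\<lambda>t. pr (A t) (f t))" if "continuous_on UNIV f" for f
    using bounded_bilinear.continuous_on[OF assms(1) assms(2) that] .
  show 1: "continuous_on UNIV (picard_term pr A y0 n)" for n
    by (induction n) (auto intro!: continuous_on_primitive *)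
  show "(picard_term pr A y0 (Suc n) has_vector_derivative pr (A t) (picard_term pr A y0 n t)) (at t)"
    using primitive_has_vector_derivative[OF *[OF 1]] by simp
qed

lemma norm_picard_term_le:
  assumes "bounded_bilinear pr" and "continuous_on UNIV A"
    and L: "L > 0" "\<And>s y. \<bar>s\<bar> \<le> T \<Longrightarrow> norm (pr (A s) y) \<le> L * norm y"
    and "\<bar>t\<bar> \<le> T"
  shows "norm (picard_term pr A y0 n t) \<le> norm y0 * (1/2) ^ n * exp (2 * L * \<bar>t\<bar>)"
  using \<open>\<bar>t\<bar> \<le> T\<close>
proof (induction n arbitrary: t)
  case 0
  have "norm y0 * 1 \<le> norm y0 * exp (2 * L * \<bar>t\<bar>)" using L by (intro mult_left_mono) auto
  then show ?case by simp
next
  case (Suc n)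
  have "norm (picard_term pr A y0 (Suc n) t) \<le> (norm y0 * (1/2) ^ n) / 2 * exp (2 * L * \<bar>t\<bar>)"
  proof (rule norm_le_exp_step[where f' = "\<lambda>s. pr (A s) (picard_term pr A y0 n s)"])
    show "norm (pr (A u) (picard_term pr A y0 n u))
            \<le> L * (norm y0 * (1/2) ^ n * exp (2 * L * \<bar>u\<bar>))" if "\<bar>u\<bar> \<le> T" for u
      using L(2)[OF that, of "picard_term pr A y0 n u"] Suc.IH[OF that] L(1)
      by (meson mult_left_mono less_imp_le order_trans)
    show "(picard_term pr A y0 (Suc n) has_vector_derivative pr (A s) (picard_term pr A y0 n s)) (at s)" for s
      by (rule picard_term_has_vector_derivative[OF assms(1,2)])
  qed (use L Suc.prems in auto)
  then show ?case by simp
qed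

text \<open>
  The differentiated series is again the Picard series, multiplied by \<open>A\<close>; both are
  dominated by geometric series on bounded intervals.
\<close>

lemma linear_ode_picard_solution:
  fixes A :: "real \<Rightarrow> 'b::real_normed_vector" and y0 :: "'a::euclidean_space"
  assumes "bounded_bilinear pr" and "continuous_on UNIV A"
  defines "y \<equiv> \<lambda>t. \<Sum>n. picard_term pr A y0 n t"
  shows "y 0 = y0" and "(y has_vector_derivative pr (A t) (y t)) (at t)"
proof -
  interpret bounded_bilinear pr by fact
  let ?p = "picard_term pr A y0"
  have p_0: "?p n 0 = 0" if "n \<noteq> 0" for n
    using that by (cases n) auto
  have "(\<lambda>n. ?p n 0) sums (?p 0 0)"
    using sums_finite[of "{0}" "\<lambda>n. ?p n 0"] p_0 by auto
  then show "y 0 = y0" by (simp add: y_def sums_iff)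
  define T where "T = \<bar>t\<bar> + 1"
  obtain L where L: "L > 0" "\<And>s y. \<bar>s\<bar> \<le> T \<Longrightarrow> norm (pr (A s) y) \<le> L * norm y"
    using linear_bound_on_compact[OF assms(2)] by metis
  define C where "C = norm y0 * exp (2 * L * T)"
  have p_bound: "norm (?p n s) \<le> C * (1/2) ^ n" if "\<bar>s\<bar> \<le> T" for n s
  proof -
    have "norm (?p n s) \<le> norm y0 * (1/2) ^ n * exp (2 * L * \<bar>s\<bar>)"
      by (rule norm_picard_term_le[OF assms(1,2) L that])
    also have "\<dots> \<le> norm y0 * (1/2) ^ n * exp (2 * L * T)"
      using that L by (intro mult_left_mono) auto
    finally show ?thesis by (simp add: C_def mult_ac)
  qed
  have geo: "summable (\<lambda>n. K * (1/2) ^ n)" for K :: real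
    by (intro summable_mult summable_geometric) auto
  have p_summable: "summable (\<lambda>n. ?p n s)" if "\<bar>s\<bar> \<le> T" for s
    using p_bound[OF that] by (intro summable_comparison_test'[OF geo[of C]])
  define f' where "f' = (\<lambda>n s. case n of 0 \<Rightarrow> 0 | Suc m \<Rightarrow> pr (A s) (?p m s))"
  have f'_bound: "norm (f' n s) \<le> 2 * L * C * (1/2) ^ n" if "\<bar>s\<bar> \<le> T" for n s
  proof (cases n)
    case 0
    then show ?thesis using L by (simp add: f'_def C_def)
  next
    case (Suc m)
    have "norm (pr (A s) (?p m s)) \<le> L * (C * (1/2) ^ m)"
      using L(2)[OF that, of "?p m s"] p_bound[OF that, of m] L(1)
      by (meson mult_left_mono less_imp_le order_trans)
    then show ?thesis using Suc by (simp add: f'_def)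
  qed
  have "\<exists>g. \<forall>s\<in>{-T..T}. (\<lambda>n. ?p n s) sums g s \<and>
          (g has_vector_derivative (\<Sum>n. f' n s)) (at s within {-T..T})"
  proof (rule has_vector_derivative_series)
    show "(?p n has_vector_derivative f' n s) (at s within {-T..T})" for n s
      using picard_term_has_vector_derivative[OF assms(1,2)]
      by (cases n) (auto simp: f'_def simp del: picard_term.simps(2)
            intro: has_vector_derivative_at_within)
    show "uniform_limit {-T..T} (\<lambda>n s. \<Sum>i<n. f' i s) (\<lambda>s. \<Sum>i. f' i s) sequentially"
      using f'_bound by (intro Weierstrass_m_test[OF _ geo[of "2 * L * C"]]) auto
    show "summable (\<lambda>n. ?p n 0)" "0 \<in> {-T..T}"
      using p_summable[of 0] by (auto simp: T_def)
  qed auto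
  then obtain g where g: "\<And>s. \<bar>s\<bar> \<le> T \<Longrightarrow> (\<lambda>n. ?p n s) sums g s"
    "\<And>s. \<bar>s\<bar> \<le> T \<Longrightarrow> (g has_vector_derivative (\<Sum>n. f' n s)) (at s within {-T..T})"
    by (metis abs_le_iff atLeastAtMost_iff minus_le_iff)
  have gy: "g s = y s" if "\<bar>s\<bar> \<le> T" for s
    using g(1)[OF that] by (simp add: y_def sums_iff)
  have tT: "\<bar>t\<bar> \<le> T" by (simp add: T_def)
  have "(\<Sum>n. f' n t) = (\<Sum>n. f' (Suc n) t)"
    using suminf_split_head[of "\<lambda>n. f' n t"]
      summable_comparison_test'[OF geo[of "2 * L * C"] f'_bound[OF tT]] by (simp add: f'_def)
  also have "\<dots> = pr (A t) (y t)"
    using bounded_linear.suminf[OF bounded_linear_right p_summable[OF tT], of "A t"]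
    by (simp add: f'_def y_def)
  finally have "(g has_vector_derivative pr (A t) (y t)) (at t within {-T<..<T})"
    using g(2)[OF tT] has_vector_derivative_within_subset[of g _ t "{-T..T}" "{-T<..<T}"] by force
  then have "(g has_vector_derivative pr (A t) (y t)) (at t)"
    by (subst (asm) has_vector_derivative_within_open) (auto simp: T_def)
  then show "(y has_vector_derivative pr (A t) (y t)) (at t)"
    by (rule has_vector_derivative_transform_within_open[where S = "{-T<..<T}"])
      (auto simp: T_def intro!: gy)
qed

section \<open>Holomorphic dependence on a parameter\<close>

text \<open>
  Polynomials in \<open>z\<close> whose coefficients are continuous functions of \<open>t\<close>. Generating them
  inductively turns continuity in \<open>t\<close>, holomorphy in \<open>z\<close> and stability under integration in \<open>t\<close> into
  simple inductions; no differentiation under the integral sign is necessary.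
\<close>

inductive polynomial_family :: "(complex \<Rightarrow> real \<Rightarrow> complex) \<Rightarrow> bool" where
  const: "continuous_on UNIV c \<Longrightarrow> polynomial_family (\<lambda>z. c)"
| mult_var: "polynomial_family f \<Longrightarrow> polynomial_family (\<lambda>z t. z * f z t)"
| add: "polynomial_family f \<Longrightarrow> polynomial_family g \<Longrightarrow> polynomial_family (\<lambda>z t. f z t + g z t)"

lemma polynomial_family_mult:
  assumes "polynomial_family f" "polynomial_family g"
  shows "polynomial_family (\<lambda>z t. f z t * g z t)"
  using assms
proof (induction f)
  case (const c)
  from const.prems show ?case
  proof (induction g)
    case (const d)
    then show ?case using \<open>continuous_on UNIV c\<close>
      by (intro polynomial_family.const continuous_intros)
  next
    case (mult_var g)
    then show ?case
      using polynomial_family.mult_var[of "\<lambda>z t. c t * g z t"] by (simp add: mult_ac)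
  next
    case (add g h)
    then show ?case
      using polynomial_family.add[of "\<lambda>z t. c t * g z t" "\<lambda>z t. c t * h z t"]
      by (simp add: algebra_simps)
  qed
next
  case (mult_var f)
  then show ?case
    using polynomial_family.mult_var[of "\<lambda>z t. f z t * g z t"] by (simp add: mult_ac)
next
  case (add f h)
  then show ?case
    using polynomial_family.add[of "\<lambda>z t. f z t * g z t" "\<lambda>z t. h z t * g z t"]
    by (simp add: algebra_simps)
qed

lemma polynomial_family_sum:
  assumes "\<And>i. i \<in> I \<Longrightarrow> polynomial_family (f i)"
  shows "polynomial_family (\<lambda>z t. \<Sum>i\<in>I. f i z t)"
  using assms
  by (induction I rule: infinite_finite_induct) (auto intro!: polynomial_family.intros)

lemma continuous_on_polynomial_family: "polynomial_family f \<Longrightarrow> continuous_on UNIV (f z)"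
  by (induction f rule: polynomial_family.induct) (auto intro!: continuous_intros)

lemma holomorphic_on_polynomial_family: "polynomial_family f \<Longrightarrow> (\<lambda>z. f z t) holomorphic_on S"
  by (induction f rule: polynomial_family.induct) (auto intro!: holomorphic_intros)

lemma polynomial_family_bounded:
  assumes "polynomial_family f"
  shows "\<exists>K. \<forall>z t. norm z \<le> r \<longrightarrow> \<bar>t\<bar> \<le> T \<longrightarrow> norm (f z t) \<le> K"
  using assms
proof (induction f)
  case (const c)
  then have "compact (c ` {-T..T})"
    by (intro compact_continuous_image) (auto intro: continuous_on_subset)
  then show ?case
    using compact_imp_bounded[of "c ` {-T..T}"] unfolding bounded_iff
    by (metis (no_types, lifting) abs_le_iff atLeastAtMost_iff imageI minus_le_iff)
next
  case (mult_var f)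
  then obtain K where K: "\<And>z t. norm z \<le> r \<Longrightarrow> \<bar>t\<bar> \<le> T \<Longrightarrow> norm (f z t) \<le> K" by blast
  have "norm (z * f z t) \<le> r * K" if "norm z \<le> r" "\<bar>t\<bar> \<le> T" for z t
    unfolding norm_mult using K[OF that] that
    by (intro mult_mono) (auto intro: order_trans[OF norm_ge_zero])
  then show ?case by blast
next
  case (add f g)
  then obtain K K' where "\<And>z t. norm z \<le> r \<Longrightarrow> \<bar>t\<bar> \<le> T \<Longrightarrow> norm (f z t) \<le> K"
    "\<And>z t. norm z \<le> r \<Longrightarrow> \<bar>t\<bar> \<le> T \<Longrightarrow> norm (g z t) \<le> K'" by metis
  then show ?case by (intro exI[of _ "K + K'"]) (auto intro!: norm_triangle_le add_mono)
qed

lemma polynomial_family_primitive: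
  assumes "polynomial_family f"
  shows "polynomial_family (\<lambda>z. primitive (f z))"
  using assms
proof (induction f)
  case (const c)
  then show ?case by (intro polynomial_family.const continuous_on_primitive)
next
  case (mult_var f)
  have "(\<lambda>t. z * primitive (f z) t) = primitive (\<lambda>t. z * f z t)" for z
    using continuous_on_polynomial_family[OF mult_var.hyps]
    by (intro primitive_unique has_vector_derivative_mult_right primitive_has_vector_derivative)
       (auto intro!: continuous_intros)
  then show ?case using polynomial_family.mult_var[OF mult_var.IH] by simp
next
  case (add f g)
  have "(\<lambda>t. primitive (f z) t + primitive (g z) t) = primitive (\<lambda>t. f z t + g z t)" for z
    using add.hyps[THEN continuous_on_polynomial_family]
    by (intro primitive_unique has_vector_derivative_add primitive_has_vector_derivative)
       (auto intro!: continuous_intros)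
  then show ?case using polynomial_family.add[OF add.IH] by simp
qed

lemma bounded_bilinear_matrix_mult:
  "bounded_bilinear ((**) :: complex^'m^'n \<Rightarrow> complex^'p^'m \<Rightarrow> complex^'p^'n)"
  unfolding bilinear_conv_bounded_bilinear[symmetric]
  by (auto simp: bilinear_def vec_eq_iff matrix_matrix_mult_def sum.distrib
      scaleR_sum_right algebra_simps intro!: linearI)

lemma primitive_vec_nth_nth:
  fixes f :: "real \<Rightarrow> complex^'m^'n"
  assumes "continuous_on UNIV f"
  shows "primitive f t $ i $ j = primitive (\<lambda>t. f t $ i $ j) t"
proof -
  have "bounded_linear (\<lambda>M::complex^'m^'n. M $ i $ j)"
    by (rule bounded_linear_compose[OF bounded_linear_vec_nth bounded_linear_vec_nth])
  then have "(\<lambda>t. primitive f t $ i $ j) = primitive (\<lambda>t. f t $ i $ j)"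
    using assms primitive_has_vector_derivative[OF assms]
    by (intro primitive_unique bounded_linear.has_vector_derivative[of "\<lambda>M. M $ i $ j"] continuous_intros)
       auto
  then show ?thesis by metis
qed

lemma continuous_on_matrix_family:
  fixes A :: "complex \<Rightarrow> real \<Rightarrow> complex^'m^'n"
  assumes "\<And>i j. polynomial_family (\<lambda>z t. A z t $ i $ j)"
  shows "continuous_on UNIV (A z)"
proof -
  have "continuous_on UNIV (\<lambda>t. \<chi> i j. A z t $ i $ j)"
    by (intro continuous_intros continuous_on_polynomial_family[OF assms])
  then show ?thesis by simp
qed

lemma polynomial_family_picard_term:
  fixes A :: "complex \<Rightarrow> real \<Rightarrow> complex^'n^'n" and M0 :: "complex^'n^'n"
  assumes "\<And>i j. polynomial_family (\<lambda>z t. A z t $ i $ j)"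
  shows "polynomial_family (\<lambda>z t. picard_term (**) (A z) M0 n t $ i $ j)"
proof (induction n arbitrary: i j)
  case 0
  then show ?case by (auto intro!: polynomial_family.intros)
next
  case (Suc n)
  have "continuous_on UNIV (\<lambda>t. A z t ** picard_term (**) (A z) M0 n t)" for z
    by (intro bounded_bilinear.continuous_on[OF bounded_bilinear_matrix_mult]
        continuous_on_matrix_family assms Suc)
  moreover have "polynomial_family (\<lambda>z. primitive (\<lambda>t. (A z t ** picard_term (**) (A z) M0 n t) $ i $ j))"
    by (subst matrix_matrix_mult_def)
      (auto intro!: polynomial_family_primitive polynomial_family_sum polynomial_family_mult assms Suc)
  ultimately show ?case by (simp add: primitive_vec_nth_nth)
qed

lemma norm_matrix_le_sum:
  fixes M :: "complex^'m^'n"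
  shows "norm M \<le> (\<Sum>i\<in>UNIV. \<Sum>j\<in>UNIV. norm (M $ i $ j))"
proof -
  have "norm M \<le> (\<Sum>i\<in>UNIV. norm (M $ i))"
    by (simp add: norm_vec_def L2_set_le_sum)
  also have "\<dots> \<le> (\<Sum>i\<in>UNIV. \<Sum>j\<in>UNIV. norm (M $ i $ j))"
    by (intro sum_mono) (simp add: norm_vec_def L2_set_le_sum)
  finally show ?thesis .
qed

text \<open>
  The partial sums are polynomials in \<open>z\<close>. The coefficient matrix is bounded for \<open>z\<close> in a disc
  and bounded \<open>t\<close>, so the geometric bound for the terms is uniform there, and the
  limit of the partial sums is holomorphic.
\<close>

lemma holomorphic_picard_series:
  fixes A :: "complex \<Rightarrow> real \<Rightarrow> complex^'n^'n" and M0 :: "complex^'n^'n"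
  assumes A: "\<And>i j. polynomial_family (\<lambda>z t. A z t $ i $ j)"
  shows "(\<lambda>z. (\<Sum>n. picard_term (**) (A z) M0 n t) $ i $ j) holomorphic_on UNIV"
proof (rule holomorphic_uniform_sequence)
  let ?p = "\<lambda>z n. picard_term (**) (A z) M0 n t"
  show "(\<lambda>z. \<Sum>n<N. ?p z n $ i $ j) holomorphic_on UNIV" for N
    by (intro holomorphic_intros holomorphic_on_polynomial_family polynomial_family_picard_term A)
  fix w :: complex
  define r where "r = norm w + 1"
  have "\<exists>K. \<forall>z s. norm z \<le> r \<longrightarrow> \<bar>s\<bar> \<le> \<bar>t\<bar> \<longrightarrow> norm (A z s $ i $ j) \<le> K" for i j
    by (rule polynomial_family_bounded[OF A])
  then obtain K where K: "\<And>i j z s. norm z \<le> r \<Longrightarrow> \<bar>s\<bar> \<le> \<bar>t\<bar> \<Longrightarrow> norm (A z s $ i $ j) \<le> K i j"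
    by metis
  obtain B where B: "B > 0" "\<And>(M :: complex^'n^'n) (N :: complex^'n^'n). norm (M ** N) \<le> norm M * norm N * B"
    using bounded_bilinear.pos_bounded[OF bounded_bilinear_matrix_mult] by blast
  define L where "L = (\<bar>\<Sum>i\<in>UNIV. \<Sum>j\<in>UNIV. K i j\<bar> + 1) * B"
  have L0: "L > 0" using B by (simp add: L_def add_nonneg_pos)
  have L: "norm (A z s ** M) \<le> L * norm M" if "norm z \<le> r" "\<bar>s\<bar> \<le> \<bar>t\<bar>"
    for z s and M :: "complex^'n^'n"
  proof -
    have "norm (A z s) \<le> (\<Sum>i\<in>UNIV. \<Sum>j\<in>UNIV. K i j)"
      by (rule order_trans[OF norm_matrix_le_sum]) (intro sum_mono K that)
    then have "norm (A z s) * norm M * B \<le> (\<bar>\<Sum>i\<in>UNIV. \<Sum>j\<in>UNIV. K i j\<bar> + 1) * norm M * B"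
      using B by (intro mult_right_mono) auto
    then show ?thesis using B(2)[of "A z s" M] by (simp add: L_def mult_ac)
  qed
  have bound: "norm (?p z n) \<le> norm M0 * exp (2 * L * \<bar>t\<bar>) * (1/2) ^ n" if "norm z \<le> r" for z n
    using norm_picard_term_le[OF bounded_bilinear_matrix_mult continuous_on_matrix_family[OF A] L0 L[OF that],
        of "\<bar>t\<bar>" t M0 n] by (simp add: mult_ac)
  have geo: "summable (\<lambda>n. norm M0 * exp (2 * L * \<bar>t\<bar>) * (1/2) ^ n)"
    by (intro summable_mult summable_geometric) auto
  have le_r: "norm z \<le> r" if "z \<in> cball w 1" for z
    using that norm_triangle_ineq2[of z w] by (auto simp: r_def dist_norm norm_minus_commute)
  have "uniform_limit (cball w 1) (\<lambda>N z. \<Sum>n<N. ?p z n) (\<lambda>z. \<Sum>n. ?p z n) sequentially"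
    using bound le_r by (intro Weierstrass_m_test[OF _ geo]) auto
  then have "uniform_limit (cball w 1) (\<lambda>N z. (\<Sum>n<N. ?p z n) $ i $ j) (\<lambda>z. (\<Sum>n. ?p z n) $ i $ j) sequentially"
    by (intro bounded_linear.uniform_limit[OF bounded_linear_vec_nth])
  then show "\<exists>d>0. cball w d \<subseteq> UNIV \<and>
      uniform_limit (cball w d) (\<lambda>N z. \<Sum>n<N. ?p z n $ i $ j) (\<lambda>z. (\<Sum>n. ?p z n) $ i $ j) sequentially"
    by (intro exI[of _ 1]) simp
qed auto

section \<open>Bounded variation of functions in the Sobolev space\<close>

lemma norm_increment_le:
  fixes f :: "real \<Rightarrow> 'a::real_normed_vector"
  assumes "a \<le> b"
    and f: "\<And>x. x \<in> {a..b} \<Longrightarrow> (f has_vector_derivative f' x) (at x within {a..b})"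
    and \<phi>: "\<And>x. x \<in> {a..b} \<Longrightarrow> (\<phi> has_vector_derivative \<phi>' x) (at x within {a..b})"
    and le: "\<And>x. x \<in> {a..b} \<Longrightarrow> norm (f' x) \<le> \<phi>' x"
  shows "norm (f b - f a) \<le> \<phi> b - \<phi> a"
proof (cases "a = b")
  case False
  show ?thesis
  proof (rule differentiable_bound_general)
    show "a < b" using False \<open>a \<le> b\<close> by simp
    show "continuous_on {a..b} f" "continuous_on {a..b} \<phi>"
      unfolding continuous_on_eq_continuous_within
      using f \<phi> has_vector_derivative_continuous by blast+
    fix x assume x: "a < x" "x < b"
    then have "at x within {a..b} = at x" by (rule at_within_Icc_at)
    then show "(f has_vector_derivative f' x) (at x)" "(\<phi> has_vector_derivative \<phi>' x) (at x)"
      "norm (f' x) \<le> \<phi>' x"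
      using f[of x] \<phi>[of x] le[of x] x by auto
  qed
qed simp

lemma le_of_nonneg_vector_derivative:
  fixes \<phi> :: "real \<Rightarrow> real"
  assumes "a \<le> b"
    and "\<And>x. x \<in> {a..b} \<Longrightarrow> (\<phi> has_vector_derivative \<phi>' x) (at x within {a..b})"
    and "\<And>x. x \<in> {a..b} \<Longrightarrow> 0 \<le> \<phi>' x"
  shows "\<phi> a \<le> \<phi> b"
  using norm_increment_le[of a b "\<lambda>_. 0::real" "\<lambda>_. 0" \<phi> \<phi>'] assms by simp

text \<open>
  A continuous function whose increments dominate those of \<open>f\<close>, such as its total variation. It
  stands for the integral of \<open>\<bar>f'\<bar>\<close> and lets the estimates be made with continuous functions.
\<close>

definition variation_majorant :: "(real \<Rightarrow> complex) \<Rightarrow> (real \<Rightarrow> real) \<Rightarrow> bool" where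
  "variation_majorant f G \<longleftrightarrow> continuous_on {0..1} G \<and>
     (\<forall>s t. 0 \<le> s \<longrightarrow> s \<le> t \<longrightarrow> t \<le> 1 \<longrightarrow> cmod (f t - f s) \<le> G t - G s)"

lemma variation_majorantD:
  assumes "variation_majorant f G" "0 \<le> s" "s \<le> t" "t \<le> 1"
  shows "cmod (f t - f s) \<le> G t - G s" and "G s \<le> G t"
proof -
  show "cmod (f t - f s) \<le> G t - G s" using assms by (auto simp: variation_majorant_def)
  then show "G s \<le> G t" using norm_ge_zero[of "f t - f s"] by linarith
qed

text \<open>
  The majorant is \<open>G t = \<integral>\<^sub>0\<^sup>t \<bar>g\<bar>\<close>, and \<open>2 \<bar>g\<bar> \<le> 1 + \<bar>g\<bar>\<^sup>2\<close> bounds \<open>G 1\<close>.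
\<close>

lemma L2_deriv_variation_majorant:
  assumes g: "L2_deriv f g"
  obtains G where "variation_majorant f G" "G 0 = 0"
    "G 1 \<le> (1 + integral\<^sup>L (lebesgue_on {0..1}) (\<lambda>t. (cmod (g t))\<^sup>2)) / 2"
proof -
  have meas: "g \<in> borel_measurable (lebesgue_on {0..1})"
    and sq: "integrable (lebesgue_on {0..1}) (\<lambda>t. (cmod (g t))\<^sup>2)"
    and int: "\<And>t. t \<in> {0..1} \<Longrightarrow> (g has_integral (f t - f 0)) {0..t}"
    using g by (auto simp: L2_deriv_def)
  have one: "integrable (lebesgue_on {0..1::real}) (\<lambda>_. 1::real)"
    by (intro absolutely_integrable_imp_integrable absolutely_integrable_continuous_real) auto
  have le: "cmod (g t) \<le> (1 + (cmod (g t))\<^sup>2) / 2" for t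
    using sum_squares_ge_zero[of "cmod (g t) - 1" 0] by (simp add: power2_eq_square algebra_simps)
  have bnd: "integrable (lebesgue_on {0..1}) (\<lambda>t. (1 + (cmod (g t))\<^sup>2) / 2)"
    using one sq by simp
  have g_int: "integrable (lebesgue_on {0..1}) g"
    by (rule Bochner_Integration.integrable_bound[OF bnd meas]) (use le in \<open>auto intro: order_trans\<close>)
  then have ng_int: "integrable (lebesgue_on {0..1}) (\<lambda>t. cmod (g t))" by simp
  then have ng: "(\<lambda>t. cmod (g t)) integrable_on {0..1}"
    by (intro integrable_on_lebesgue_on) auto
  define G where "G = (\<lambda>t. integral {0..t} (\<lambda>s. cmod (g s)))"
  show ?thesis
  proof
    show "G 0 = 0" by (simp add: G_def)
    have "G 1 = integral\<^sup>L (lebesgue_on {0..1}) (\<lambda>t. cmod (g t))"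
      unfolding G_def by (rule lebesgue_integral_eq_integral[OF ng_int, symmetric]) auto
    also have "\<dots> \<le> integral\<^sup>L (lebesgue_on {0..1}) (\<lambda>t. (1 + (cmod (g t))\<^sup>2) / 2)"
      using ng_int bnd le by (intro integral_mono)
    also have "\<dots> = (1 + integral\<^sup>L (lebesgue_on {0..1}) (\<lambda>t. (cmod (g t))\<^sup>2)) / 2"
      using one sq by (simp add: measure_restrict_space)
    finally show "G 1 \<le> (1 + integral\<^sup>L (lebesgue_on {0..1}) (\<lambda>t. (cmod (g t))\<^sup>2)) / 2" .
    show "variation_majorant f G"
      unfolding variation_majorant_def
    proof (intro conjI allI impI)
      show "continuous_on {0..1} G"
        unfolding G_def by (rule indefinite_integral_continuous_1[OF ng])
      fix s t :: real assume st: "0 \<le> s" "s \<le> t" "t \<le> 1"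
      have gi: "g integrable_on {0..t}" using int[of t] st by auto
      have ngi: "(\<lambda>s. cmod (g s)) integrable_on {0..t}"
        using integrable_on_subinterval[OF ng] st by auto
      have "f t - f 0 = integral {0..t} g" "f s - f 0 = integral {0..s} g"
        using int[of t] int[of s] st by (auto simp: integral_unique)
      moreover have "integral {0..s} g + integral {s..t} g = integral {0..t} g"
        using st gi by (intro Henstock_Kurzweil_Integration.integral_combine) auto
      ultimately have "f t - f s = integral {s..t} g" by (simp add: algebra_simps)
      moreover have "cmod (integral {s..t} g) \<le> integral {s..t} (\<lambda>s. cmod (g s))"
        using st gi ngi by (intro integral_norm_bound_integral) (auto intro: integrable_on_subinterval)
      moreover have "integral {0..s} (\<lambda>s. cmod (g s)) + integral {s..t} (\<lambda>s. cmod (g s)) = G t"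
        unfolding G_def using st ngi by (intro Henstock_Kurzweil_Integration.integral_combine) auto
      ultimately show "cmod (f t - f s) \<le> G t - G s" by (simp add: G_def)
    qed
  qed
qed

lemma continuous_on_of_variation_majorant:
  assumes "variation_majorant f G"
  shows "continuous_on {0..1} f"
proof -
  have contG: "continuous_on {0..1} G" using assms by (simp add: variation_majorant_def)
  have *: "dist (f t) (f s) \<le> dist (G t) (G s)" if "s \<in> {0..1}" "t \<in> {0..1}" for s t
  proof (cases "s \<le> t")
    case True
    then show ?thesis using variation_majorantD[OF assms, of s t] that by (simp add: dist_norm)
  next
    case False
    then show ?thesis using variation_majorantD[OF assms, of t s] that
      by (simp add: dist_norm norm_minus_commute)
  qed
  show ?thesis
    unfolding continuous_on_iff
  proof (intro ballI allI impI)
    fix x e :: real assume x: "x \<in> {0..1}" and "e > 0"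
    then obtain d where "d > 0" "\<And>y. y \<in> {0..1} \<Longrightarrow> dist y x < d \<Longrightarrow> dist (G y) (G x) < e"
      using contG unfolding continuous_on_iff by meson
    then show "\<exists>d>0. \<forall>y\<in>{0..1}. dist y x < d \<longrightarrow> dist (f y) (f x) < e"
      using *[OF x] by (meson le_less_trans)
  qed
qed

lemma continuous_on_periodic:
  fixes f :: "real \<Rightarrow> 'a::topological_space"
  assumes per: "\<And>t. f (t + 1) = f t" and cont: "continuous_on {0..1} f"
  shows "continuous_on UNIV f"
proof -
  have shift: "f (t - of_int n) = f t" for n t
  proof (induction n rule: int_induct[where k = 0])
    case base
    then show ?case by simp
  next
    case (step1 n)
    then show ?case using per[of "t - of_int (n + 1)"] by (simp add: algebra_simps)
  next
    case (step2 n)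
    then show ?case using per[of "t - of_int n"] by (simp add: algebra_simps)
  qed
  have int: "continuous_on {of_int n..of_int n + 1} f" for n :: int
  proof -
    have "continuous_on {of_int n..of_int n + 1} (\<lambda>t. f (t - of_int n))"
      by (rule continuous_on_compose2[OF cont]) (auto intro!: continuous_intros)
    then show ?thesis by (simp add: shift)
  qed
  have "isCont f x" for x
  proof -
    define n where "n = \<lfloor>x\<rfloor>"
    have n: "of_int n \<le> x" "x < of_int n + 1" by (auto simp: n_def)
    have "continuous_on ({of_int (n-1)..of_int (n-1) + 1} \<union> {of_int n..of_int n + 1}) f"
      by (intro continuous_on_closed_Un int) auto
    moreover have "{of_int n - 1<..<of_int n + 1} \<subseteq> {of_int (n-1)..of_int (n-1) + 1} \<union> {of_int n..of_int n + 1 :: real}"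
      by auto
    ultimately have "continuous_on {of_int n - 1<..<of_int n + 1} f"
      by (rule continuous_on_subset)
    then show ?thesis
      using n by (subst (asm) continuous_on_eq_continuous_at) auto
  qed
  then show ?thesis by (simp add: continuous_on_eq_continuous_at)
qed

text \<open>
  For the supremum bound, \<open>\<bar>f t\<bar> \<le> \<bar>f s\<bar> + G 1 \<le> (1 + \<bar>f s\<bar>\<^sup>2) / 2 + G 1\<close> is averaged over
  all \<open>s\<close> in the unit interval.
\<close>

lemma H1_circle_bounds:
  assumes f: "f \<in> H1_circle" and R: "H1_norm f \<le> R"
  obtains G where "continuous_on UNIV f" "variation_majorant f G" "G 0 = 0" "G 1 \<le> 1 + R\<^sup>2"
    "\<And>t. t \<in> {0..1} \<Longrightarrow> cmod (f t) \<le> 1 + R\<^sup>2"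
proof -
  define g where "g = (SOME g. L2_deriv f g)"
  have g: "L2_deriv f g" 
    using f someI_ex[of "L2_deriv f"] by (auto simp: H1_circle_def g_def)
  define P Q where "P = integral\<^sup>L (lebesgue_on {0..1}) (\<lambda>t. (cmod (f t))\<^sup>2)"
    and "Q = integral\<^sup>L (lebesgue_on {0..1}) (\<lambda>t. (cmod (g t))\<^sup>2)"
  have PQ0: "0 \<le> P" "0 \<le> Q" unfolding P_def Q_def by (auto intro!: integral_nonneg_AE)
  have norm: "H1_norm f = sqrt (P + Q)" by (simp add: H1_norm_def P_def Q_def g_def)
  have "P + Q = (H1_norm f)\<^sup>2" unfolding norm using PQ0 by simp
  also have "\<dots> \<le> R\<^sup>2" using R norm PQ0 by (intro power_mono) auto
  finally have PQ: "P + Q \<le> R\<^sup>2" .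
  obtain G where G: "variation_majorant f G" "G 0 = 0" "G 1 \<le> (1 + Q) / 2"
    using L2_deriv_variation_majorant[OF g] unfolding Q_def by metis
  have cont: "continuous_on {0..1} f" by (rule continuous_on_of_variation_majorant[OF G(1)])
  show ?thesis
  proof
    show "continuous_on UNIV f"
      using f cont by (intro continuous_on_periodic) (auto simp: H1_circle_def)
    show "variation_majorant f G" "G 0 = 0" by fact+
    show "G 1 \<le> 1 + R\<^sup>2" using G(3) PQ PQ0 by simp
    fix t :: real assume t: "t \<in> {0..1}"
    have le: "cmod (f t) \<le> (1 + (cmod (f s))\<^sup>2) / 2 + G 1" if s: "s \<in> {0..1}" for s
    proof -
      have G_mono: "G x \<le> G y" if "0 \<le> x" "x \<le> y" "y \<le> 1" for x y
        using variation_majorantD(2)[OF G(1) that] .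
      have "cmod (f t - f s) \<le> G 1"
      proof (cases "s \<le> t")
        case True
        then show ?thesis using variation_majorantD(1)[OF G(1), of s t] G_mono[of 0 s] G_mono[of t 1] s t G(2) by simp
      next
        case False
        then show ?thesis using variation_majorantD(1)[OF G(1), of t s] G_mono[of 0 t] G_mono[of s 1] s t G(2)
          by (simp add: norm_minus_commute)
      qed
      moreover have "cmod (f t) \<le> cmod (f s) + cmod (f t - f s)" by (rule norm_triangle_sub)
      moreover have "cmod (f s) \<le> (1 + (cmod (f s))\<^sup>2) / 2"
        using sum_squares_ge_zero[of "cmod (f s) - 1" 0] by (simp add: power2_eq_square algebra_simps)
      ultimately show ?thesis by linarith
    qed
    have sq: "(\<lambda>s. (cmod (f s))\<^sup>2) absolutely_integrable_on {0..1}"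
      by (intro absolutely_integrable_continuous_real continuous_intros cont)
    then have sq': "integrable (lebesgue_on {0..1}) (\<lambda>s. (cmod (f s))\<^sup>2)"
      by (simp add: integrable_restrict_space set_integrable_def)
    have "integral {0..1} (\<lambda>s::real. cmod (f t)) \<le> integral {0..1} (\<lambda>s. (1 + (cmod (f s))\<^sup>2) / 2 + G 1)"
      by (rule Henstock_Kurzweil_Integration.integral_le) (use le in \<open>auto intro!: integrable_continuous_real continuous_intros cont\<close>)
    also have "\<dots> = (1 + P) / 2 + G 1"
    proof -
      have "((\<lambda>s. (cmod (f s))\<^sup>2) has_integral P) {0..1}"
        unfolding P_def lebesgue_integral_eq_integral[OF sq', simplified]
        by (intro integrable_integral integrable_continuous_real continuous_intros cont)
      then have "((\<lambda>s. (1 + (cmod (f s))\<^sup>2) / 2 + G 1) has_integral (1 * (1 - 0) + P) / 2 + G 1 * (1 - 0)) {0..1}"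
        by (intro has_integral_add has_integral_divide) (auto intro: has_integral_const_real[of _ 0 1, simplified])
      then show ?thesis by (simp add: integral_unique)
    qed
    finally have "cmod (f t) \<le> (1 + P) / 2 + G 1" by simp
    then show "cmod (f t) \<le> 1 + R\<^sup>2" using G(3) PQ PQ0 by argo
  qed
qed

lemma variation_majorant_sum:
  assumes "finite I" "i \<in> I" "\<And>j. j \<in> I \<Longrightarrow> variation_majorant (f j) (G j)"
  shows "variation_majorant (f i) (\<lambda>t. \<Sum>j\<in>I. G j t)"
  unfolding variation_majorant_def
proof (intro conjI allI impI)
  show "continuous_on {0..1} (\<lambda>t. \<Sum>j\<in>I. G j t)"
    using assms(3) by (intro continuous_on_sum) (auto simp: variation_majorant_def)
  fix s t :: real assume st: "0 \<le> s" "s \<le> t" "t \<le> 1"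
  have "cmod (f i t - f i s) \<le> G i t - G i s"
    by (rule variation_majorantD(1)[OF assms(3)[OF assms(2)] st])
  also have "\<dots> \<le> (\<Sum>j\<in>I. G j t - G j s)"
    using assms variation_majorantD(2)[OF assms(3) st] by (intro member_le_sum) auto
  finally show "cmod (f i t - f i s) \<le> (\<Sum>j\<in>I. G j t) - (\<Sum>j\<in>I. G j s)"
    by (simp add: sum_subtractf)
qed

lemma variation_majorant_uminus: "variation_majorant f G \<Longrightarrow> variation_majorant (\<lambda>t. - f t) G"
  by (simp add: variation_majorant_def norm_minus_commute)

section \<open>Smoothing by averages over short intervals\<close>

text \<open>
  A bound for the oscillation of \<open>f\<close> on the window from \<open>t\<close> to \<open>t + h\<close>, if \<open>G\<close> is a variation
  majorant of \<open>f\<close>. The minimum extends \<open>G\<close> beyond 1 by its value at 1.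
\<close>

definition modulus_increment :: "(real \<Rightarrow> real) \<Rightarrow> real \<Rightarrow> real \<Rightarrow> real" where
  "modulus_increment G h t = G (min (t + h) 1) - G t"

text \<open>
  The average \<open>q t = (1/h) \<integral>\<^bsub>t\<^esub>\<^bsup>t+h\<^esup> f\<close>, with \<open>f\<close> extended beyond 1 by the constant \<open>f 1\<close>, is differentiable
  with derivative \<open>(f (t + h) - f t) / h\<close>; both \<open>q - f\<close> and \<open>h q'\<close> are bounded by the
  oscillation of \<open>f\<close> on the window.
\<close>

lemma steklov_average:
  assumes G: "variation_majorant f G" and h: "h > 0"
    and R: "\<And>t. t \<in> {0..1} \<Longrightarrow> cmod (f t) \<le> R"
  obtains q q' where
    "\<And>t. t \<in> {0..1} \<Longrightarrow> (q has_vector_derivative q' t) (at t within {0..1})"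
    "\<And>t. t \<in> {0..1} \<Longrightarrow> cmod (q t - f t) \<le> modulus_increment G h t"
    "\<And>t. t \<in> {0..1} \<Longrightarrow> cmod (q' t) \<le> modulus_increment G h t / h"
    "\<And>t. t \<in> {0..1} \<Longrightarrow> cmod (q t) \<le> R"
proof -
  define e where "e = (\<lambda>t. f (min t 1))"
  have cont: "continuous_on {0..1+h} e"
    unfolding e_def
    by (rule continuous_on_compose2[OF continuous_on_of_variation_majorant[OF G]])
       (auto intro!: continuous_intros)
  then obtain F where F: "\<And>x. x \<in> {0..1+h} \<Longrightarrow> (F has_vector_derivative e x) (at x within {0..1+h})"
    using antiderivative_continuous by blast
  have window: "(F has_vector_derivative e x) (at x within {t..t+h})" if "t \<in> {0..1}" "x \<in> {t..t+h}" for t x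
    by (rule has_vector_derivative_within_subset[OF F]) (use that in auto)
  show ?thesis
  proof
    fix t :: real assume t: "t \<in> {0..1}"
    have e_close: "cmod (e x - f t) \<le> modulus_increment G h t" if "x \<in> {t..t+h}" for x
    proof -
      have "G (min x 1) \<le> G (min (t + h) 1)"
        using that t by (intro variation_majorantD(2)[OF G]) auto
      moreover have "cmod (e x - f t) \<le> G (min x 1) - G t"
        unfolding e_def using that t by (intro variation_majorantD(1)[OF G]) auto
      ultimately show ?thesis by (simp add: modulus_increment_def)
    qed
    show "((\<lambda>t. (F (t + h) - F t) /\<^sub>R h) has_vector_derivative (e (t + h) - e t) /\<^sub>R h) (at t within {0..1})"
    proof (rule bounded_linear.has_vector_derivative[OF bounded_linear_scaleR_right],
           rule has_vector_derivative_diff)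
      have "((F \<circ> (\<lambda>t. t + h)) has_vector_derivative 1 *\<^sub>R e (t + h)) (at t within {0..1})"
        by (rule vector_diff_chain_within)
           (use t h in \<open>auto intro!: derivative_eq_intros has_vector_derivative_within_subset[OF F]\<close>)
      then show "((\<lambda>t. F (t + h)) has_vector_derivative e (t + h)) (at t within {0..1})"
        by (simp add: o_def)
      show "(F has_vector_derivative e t) (at t within {0..1})"
        by (rule has_vector_derivative_within_subset[OF F]) (use t h in auto)
    qed
    have "norm ((F (t + h) - (t + h) *\<^sub>R f t) - (F t - t *\<^sub>R f t))
        \<le> (t + h) * modulus_increment G h t - t * modulus_increment G h t"
      by (rule norm_increment_le[where f' = "\<lambda>x. e x - 1 *\<^sub>R f t" and \<phi>' = "\<lambda>_. modulus_increment G h t"])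
         (use h t e_close window in \<open>auto intro!: derivative_eq_intros\<close>)
    also have "(F (t + h) - (t + h) *\<^sub>R f t) - (F t - t *\<^sub>R f t) = h *\<^sub>R ((F (t + h) - F t) /\<^sub>R h - f t)"
      using h by (simp add: algebra_simps)
    finally have "h * cmod ((F (t + h) - F t) /\<^sub>R h - f t) \<le> h * modulus_increment G h t"
      unfolding norm_scaleR left_diff_distrib[symmetric] using h by simp
    then show "cmod ((F (t + h) - F t) /\<^sub>R h - f t) \<le> modulus_increment G h t"
      by (rule mult_left_le_imp_le[OF _ h])
    have "e t = f t" using t by (simp add: e_def min_def)
    then show "cmod ((e (t + h) - e t) /\<^sub>R h) \<le> modulus_increment G h t / h"
      using e_close[of "t + h"] h by (simp add: divide_inverse mult.commute)
    have "norm (F (t + h) - F t) \<le> (t + h) * R - t * R"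
      by (rule norm_increment_le[where f' = e and \<phi>' = "\<lambda>_. R"])
         (use h t R window in \<open>auto intro!: derivative_eq_intros simp: e_def\<close>)
    then show "cmod ((F (t + h) - F t) /\<^sub>R h) \<le> R"
      unfolding norm_scaleR using h by (simp add: field_simps)
  qed
qed

text \<open>
  The integral of \<open>G (t + h) - G t\<close> over the unit interval telescopes to the difference of two
  integrals of \<open>G\<close> over intervals of length \<open>h\<close>. This is the gain over a pointwise bound, which for
  functions in \<open>H\<^sup>1\<close> would only be of order \<open>h\<^sup>1\<^sup>/\<^sup>2\<close>.
\<close>

lemma modulus_increment_primitive:
  assumes G: "variation_majorant f G" and h: "h > 0"
  obtains \<Phi> where
    "\<And>t. t \<in> {0..1} \<Longrightarrow> (\<Phi> has_vector_derivative modulus_increment G h t) (at t within {0..1})"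
    "\<Phi> 1 - \<Phi> 0 \<le> h * (G 1 - G 0)"
proof -
  define e where "e = (\<lambda>t. G (min t 1))"
  have contG: "continuous_on {0..1} G" using G by (simp add: variation_majorant_def)
  have "continuous_on {0..1+h} e"
    unfolding e_def by (rule continuous_on_compose2[OF contG]) (auto intro!: continuous_intros)
  then obtain P where P: "\<And>x. x \<in> {0..1+h} \<Longrightarrow> (P has_vector_derivative e x) (at x within {0..1+h})"
    using antiderivative_continuous by blast
  show ?thesis
  proof
    fix t :: real assume t: "t \<in> {0..1}"
    have "((P \<circ> (\<lambda>t. t + h)) has_vector_derivative 1 *\<^sub>R e (t + h)) (at t within {0..1})"
      by (rule vector_diff_chain_within)
         (use t h in \<open>auto intro!: derivative_eq_intros has_vector_derivative_within_subset[OF P]\<close>)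
    moreover have "(P has_vector_derivative e t) (at t within {0..1})"
      by (rule has_vector_derivative_within_subset[OF P]) (use t h in auto)
    moreover have "e (t + h) - e t = modulus_increment G h t"
      using t by (simp add: e_def modulus_increment_def min_def)
    ultimately show "((\<lambda>t. P (t + h) - P t) has_vector_derivative modulus_increment G h t) (at t within {0..1})"
      using has_vector_derivative_diff[of "\<lambda>t. P (t + h)" "e (t + h)" "at t within {0..1}" P "e t"]
      by (simp add: o_def)
  next
    have "1 * G 1 - P 1 \<le> (1 + h) * G 1 - P (1 + h)"
      by (rule le_of_nonneg_vector_derivative[where \<phi>' = "\<lambda>x. 1 * G 1 - e x"])
         (use h in \<open>auto intro!: derivative_eq_intros has_vector_derivative_within_subset[OF P] simp: e_def min_def\<close>)
    moreover have "P 0 - 0 * G 0 \<le> P h - h * G 0"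
      by (rule le_of_nonneg_vector_derivative[where \<phi>' = "\<lambda>x. e x - 1 * G 0"])
         (use h in \<open>auto intro!: derivative_eq_intros has_vector_derivative_within_subset[OF P]
             variation_majorantD(2)[OF G] simp: e_def\<close>)
    ultimately show "(P (1 + h) - P 1) - (P (0 + h) - P 0) \<le> h * (G 1 - G 0)"
      by (simp add: algebra_simps)
  qed
qed

section \<open>Diagonalisation by a gauge transformation\<close>

text \<open>
  Here \<open>a' = \<alpha> a + \<beta> c\<close> and \<open>c' = \<gamma> a - \<alpha> c\<close> are the equations for a column, \<open>x1\<close>, \<dots>, \<open>x4\<close> are values of
  the potential, \<open>q1\<close> and \<open>q3\<close> those of its averages, and the left-hand side is \<open>(a + p c)' - k (a + p c)\<close>.
  The choice of \<open>p\<close> makes \<open>2 k p\<close> cancel \<open>\<beta>\<close> up to averaging errors. On the diagonal,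
  \<open>2 z p = \<i> s q1 + O (1/z)\<close>, so \<open>p \<gamma>\<close> cancels the entry \<open>- \<i> s x1 x2\<close>. The sign \<open>s = \<plusminus>1\<close> lets the same
  identity serve for the second component: exchanging \<open>a\<close> and \<open>c\<close> turns \<open>s\<close>, \<open>x1\<close>, \<open>x2\<close>, \<open>x3\<close>, \<open>x4\<close> into
  \<open>- s\<close>, \<open>x2\<close>, \<open>x1\<close>, \<open>- x4\<close>, \<open>- x3\<close>.
\<close>

lemma gauge_identity:
  fixes z s a c x1 x2 x3 x4 q1 q3 p p' :: complex
  assumes "z \<noteq> 0" "s\<^sup>2 = 1"
  defines "k \<equiv> - 2 * \<i> * s * z\<^sup>2"
  assumes p: "2 * k * p = 2 * z * q1 + \<i> * q3"
  shows "((k - \<i> * s * x1 * x2) * a + (2 * z * x1 + \<i> * x3) * c) + p' * c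
           + p * ((2 * z * x2 - \<i> * x4) * a - (k - \<i> * s * x1 * x2) * c) - k * (a + p * c)
       = (\<i> * s * x2 * (q1 - x1) - s * q3 * x2 / (2 * z) - \<i> * p * x4) * a
         + (2 * z * (x1 - q1) + \<i> * (x3 - q3) + p' + \<i> * s * p * x1 * x2) * c"
proof -
  have ss: "s * s = 1" using assms(2) by (simp add: power2_eq_square)
  have "2 * z * p = 2 * k * p * (s * \<i> / (2 * z))"
    using \<open>z \<noteq> 0\<close> ss by (simp add: k_def power2_eq_square field_simps)
  also have "\<dots> = \<i> * s * q1 - s * q3 / (2 * z)"
    unfolding p using \<open>z \<noteq> 0\<close> by (simp add: field_simps)
  finally have zp: "2 * z * p = \<i> * s * q1 - s * q3 / (2 * z)" .
  have "((k - \<i> * s * x1 * x2) * a + (2 * z * x1 + \<i> * x3) * c) + p' * c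
           + p * ((2 * z * x2 - \<i> * x4) * a - (k - \<i> * s * x1 * x2) * c) - k * (a + p * c)
      = (- \<i> * s * x1 * x2 + (2 * z * p) * x2 - \<i> * p * x4) * a
        + (2 * z * x1 + \<i> * x3 - 2 * k * p + p' + \<i> * s * p * x1 * x2) * c"
    by (simp add: algebra_simps)
  also have "\<dots> = (\<i> * s * x2 * (q1 - x1) - s * q3 * x2 / (2 * z) - \<i> * p * x4) * a
         + (2 * z * (x1 - q1) + \<i> * (x3 - q3) + p' + \<i> * s * p * x1 * x2) * c"
    unfolding zp p by (simp add: algebra_simps)
  finally show ?thesis .
qed

lemma gauge_factor_bound:
  fixes z s q1 q3 k p :: complex
  assumes "1 \<le> cmod z" "cmod s = 1" "k = - 2 * \<i> * s * z\<^sup>2" "2 * k * p = 2 * z * q1 + \<i> * q3"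
    and "cmod q1 \<le> B" "cmod q3 \<le> B"
  shows "cmod p \<le> B / cmod z"
proof -
  have B: "0 \<le> B" using assms(5) norm_ge_zero order_trans by blast
  have "4 * (cmod z)\<^sup>2 * cmod p = cmod (2 * k * p)"
    using assms(2) by (simp add: assms(3) norm_mult norm_power)
  also have "\<dots> \<le> 2 * cmod z * B + B"
    unfolding assms(4) using assms(5,6)
    by (intro norm_triangle_le add_mono) (auto simp: norm_mult intro!: mult_left_mono)
  also have "\<dots> \<le> 4 * cmod z * B"
    using mult_right_mono[OF assms(1) B] B by (simp add: algebra_simps)
  finally have "cmod z * (cmod z * cmod p) \<le> cmod z * B" by (simp add: power2_eq_square mult_ac)
  then have "cmod z * cmod p \<le> B" by (rule mult_left_le_imp_le) (use assms(1) in linarith)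
  moreover have "0 < cmod z" using assms(1) by linarith
  ultimately show ?thesis by (simp add: pos_le_divide_eq mult.commute)
qed

text \<open>
  The factor \<open>\<bar>z\<bar>\<^sup>2\<close> in the bounds for \<open>q1'\<close> and \<open>q3'\<close> is \<open>1/h\<close> for averages over windows of length
  \<open>h = \<bar>z\<bar>\<^sup>-\<^sup>2\<close>. This length balances the two errors: \<open>z (x1 - q1)\<close> and \<open>p'\<close>, which is about \<open>q1' / z\<close>, are
  then both at most of order \<open>\<bar>z\<bar> g\<close>, and \<open>g\<close> has an integral of order \<open>\<bar>z\<bar>\<^sup>-\<^sup>2\<close>.
\<close>

lemma gauge_defect_bound:
  fixes z s a c x1 x2 x3 x4 q1 q3 p p' :: complex
  assumes z: "1 \<le> cmod z" and s: "s\<^sup>2 = 1" and k: "k = - 2 * \<i> * s * z\<^sup>2"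
    and p: "2 * k * p = 2 * z * q1 + \<i> * q3" and p': "2 * k * p' = 2 * z * q1' + \<i> * q3'"
    and R: "1 \<le> R" "cmod x1 \<le> R" "cmod x2 \<le> R" "cmod x4 \<le> R" "cmod q1 \<le> R" "cmod q3 \<le> R"
    and g: "cmod (q1 - x1) \<le> g" "cmod (q3 - x3) \<le> g"
      "cmod q1' \<le> g * (cmod z)\<^sup>2" "cmod q3' \<le> g * (cmod z)\<^sup>2"
  shows "cmod (((k - \<i> * s * x1 * x2) * a + (2 * z * x1 + \<i> * x3) * c) + p' * c
           + p * ((2 * z * x2 - \<i> * x4) * a - (k - \<i> * s * x1 * x2) * c) - k * (a + p * c))
       \<le> (4 * R * cmod z * g + 2 * R ^ 3 / cmod z) * (cmod a + cmod c)"
proof -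
  have s1: "cmod s = 1" using s by (auto simp: power2_eq_1_iff)
  have z0: "z \<noteq> 0" using z by auto
  have g0: "0 \<le> g" using g(1) norm_ge_zero order_trans by blast
  have pb: "cmod p \<le> R / cmod z" by (rule gauge_factor_bound[OF z s1 k p R(5,6)])
  have p'b: "cmod p' \<le> cmod z * g"
    using gauge_factor_bound[OF z s1 k p' g(3,4)] z0 by (simp add: power2_eq_square mult_ac)
  have R3: "R\<^sup>2 \<le> R ^ 3" "R \<le> R\<^sup>2" using R(1) by (auto intro: power_increasing self_le_power)
  have zg: "g \<le> cmod z * g" using mult_right_mono[OF z g0] by simp
  have Rzg: "cmod z * g \<le> R * cmod z * g"
    using mult_right_mono[OF R(1), of "cmod z * g"] g0 by (simp add: mult.assoc)
  have Rg: "R * g \<le> R * cmod z * g" using mult_left_mono[OF zg, of R] R(1) by (simp add: mult.assoc)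
  have g1: "0 \<le> R * cmod z * g" using g0 R(1) by simp
  have "cmod (\<i> * s * x2 * (q1 - x1) - s * q3 * x2 / (2 * z) - \<i> * p * x4)
      \<le> R * g + R * R / (2 * cmod z) + R / cmod z * R"
  proof (intro order_trans[OF norm_triangle_ineq4] add_mono)
    show "cmod (\<i> * s * x2 * (q1 - x1)) \<le> R * g"
      using mult_mono[OF R(3) g(1)] R(1) by (simp add: norm_mult s1)
    have "cmod q3 * cmod x2 / (2 * cmod z) \<le> R * R / (2 * cmod z)"
      using R by (intro divide_right_mono mult_mono) auto
    then show "cmod (s * q3 * x2 / (2 * z)) \<le> R * R / (2 * cmod z)"
      by (simp add: norm_mult norm_divide s1)
    show "cmod (\<i> * p * x4) \<le> R / cmod z * R"
      using mult_mono[OF pb R(4)] R(1) by (simp add: norm_mult)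
  qed
  also have "\<dots> = R * g + 3/2 * (R\<^sup>2 / cmod z)" by (simp add: power2_eq_square)
  also have "\<dots> \<le> 4 * R * cmod z * g + 2 * R ^ 3 / cmod z"
  proof -
    have "R\<^sup>2 / cmod z \<le> R ^ 3 / cmod z" using R3 z by (intro divide_right_mono) auto
    moreover have "0 \<le> R\<^sup>2 / cmod z" by simp
    ultimately have "R * g + 3/2 * (R\<^sup>2 / cmod z) \<le> 4 * (R * cmod z * g) + 2 * (R ^ 3 / cmod z)"
      using Rg g1 by linarith
    then show ?thesis by (simp add: mult_ac)
  qed
  finally have 1: "cmod (\<i> * s * x2 * (q1 - x1) - s * q3 * x2 / (2 * z) - \<i> * p * x4)
      \<le> 4 * R * cmod z * g + 2 * R ^ 3 / cmod z" .
  have "cmod (2 * z * (x1 - q1) + \<i> * (x3 - q3) + p' + \<i> * s * p * x1 * x2)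
      \<le> 2 * cmod z * g + g + cmod z * g + R / cmod z * R * R"
  proof (intro order_trans[OF norm_triangle_ineq] add_mono)
    show "cmod (2 * z * (x1 - q1)) \<le> 2 * cmod z * g" "cmod (\<i> * (x3 - q3)) \<le> g"
      using g(1,2) by (auto simp: norm_mult norm_minus_commute intro!: mult_left_mono)
    show "cmod p' \<le> cmod z * g" by (rule p'b)
    have "cmod p * cmod x1 * cmod x2 \<le> R / cmod z * R * R"
      using R pb by (intro mult_mono) auto
    then show "cmod (\<i> * s * p * x1 * x2) \<le> R / cmod z * R * R" by (simp add: norm_mult s1)
  qed
  also have "R / cmod z * R * R = R ^ 3 / cmod z" by (simp add: power3_eq_cube)
  also have "2 * cmod z * g + g + cmod z * g + R ^ 3 / cmod z
      \<le> 4 * R * cmod z * g + 2 * R ^ 3 / cmod z"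
  proof -
    have "0 \<le> R ^ 3 / cmod z" using R by simp
    then have "2 * (cmod z * g) + g + cmod z * g + R ^ 3 / cmod z \<le> 4 * (R * cmod z * g) + 2 * (R ^ 3 / cmod z)"
      using zg Rzg by linarith
    then show ?thesis by (simp add: mult_ac)
  qed
  finally have 2: "cmod (2 * z * (x1 - q1) + \<i> * (x3 - q3) + p' + \<i> * s * p * x1 * x2)
      \<le> 4 * R * cmod z * g + 2 * R ^ 3 / cmod z" .
  show ?thesis
    unfolding k gauge_identity[OF z0 s p[unfolded k]]
    unfolding distrib_left using 1 2
    by (intro norm_triangle_le add_mono) (auto simp: norm_mult intro!: mult_right_mono)
qed

text \<open>
  Allows passing between the original column and the transformed one at the
  expense of a factor 2.
\<close>

lemma gauge_norm_equivalence:
  fixes a c p r :: complex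
  assumes "cmod p \<le> 1/4" "cmod r \<le> 1/4"
  shows "cmod a + cmod c \<le> 2 * (cmod (a + p * c) + cmod (c + r * a))"
    and "cmod (a + p * c) + cmod (c + r * a) \<le> 2 * (cmod a + cmod c)"
proof -
  have pc: "cmod (p * c) \<le> 1/4 * cmod c" and ra: "cmod (r * a) \<le> 1/4 * cmod a"
    unfolding norm_mult by (rule mult_right_mono, rule assms, rule norm_ge_zero)+
  have "cmod a \<le> cmod (a + p * c) + cmod (p * c)" "cmod c \<le> cmod (c + r * a) + cmod (r * a)"
    using norm_triangle_ineq4[of "a + p * c" "p * c"] norm_triangle_ineq4[of "c + r * a" "r * a"] by auto
  then show "cmod a + cmod c \<le> 2 * (cmod (a + p * c) + cmod (c + r * a))"
    using pc ra norm_ge_zero[of a] norm_ge_zero[of c] by argo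
  show "cmod (a + p * c) + cmod (c + r * a) \<le> 2 * (cmod a + cmod c)"
    using pc ra norm_triangle_ineq[of a "p * c"] norm_triangle_ineq[of c "r * a"]
      norm_ge_zero[of a] norm_ge_zero[of c] by argo
qed

section \<open>Asymptotics of solutions\<close>

text \<open>
  The energy \<open>\<bar>u\<bar>\<^sup>2 + \<bar>v\<bar>\<^sup>2\<close> grows at most at the rate \<open>2 \<bar>Re k\<bar> + 4 \<epsilon>\<close>, which bounds \<open>u\<close> and \<open>v\<close> by
  a multiple of \<open>exp (\<bar>Re k\<bar> t)\<close>. With this bound, the variation of constants formula for \<open>u\<close> gives
  an error proportional to the integral of \<open>\<epsilon>\<close>: the factor \<open>exp (k (1 - t))\<close> and the size of \<open>u\<close> at time \<open>t\<close>
  multiply to \<open>exp \<bar>Re k\<bar>\<close> whatever the sign of \<open>Re k\<close>.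
\<close>

lemma diagonal_perturbation:
  fixes u v :: "real \<Rightarrow> complex" and k :: complex and \<epsilon> \<Phi> :: "real \<Rightarrow> real"
  assumes u: "\<And>t. t \<in> {0..1} \<Longrightarrow> (u has_vector_derivative (k * u t + E1 t)) (at t within {0..1})"
    and v: "\<And>t. t \<in> {0..1} \<Longrightarrow> (v has_vector_derivative (- k * v t + E2 t)) (at t within {0..1})"
    and E1: "\<And>t. t \<in> {0..1} \<Longrightarrow> cmod (E1 t) \<le> \<epsilon> t * (cmod (u t) + cmod (v t))"
    and E2: "\<And>t. t \<in> {0..1} \<Longrightarrow> cmod (E2 t) \<le> \<epsilon> t * (cmod (u t) + cmod (v t))"
    and \<Phi>: "\<And>t. t \<in> {0..1} \<Longrightarrow> (\<Phi> has_vector_derivative \<epsilon> t) (at t within {0..1})"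
    and \<epsilon>0: "\<And>t. t \<in> {0..1} \<Longrightarrow> 0 \<le> \<epsilon> t"
    and I: "\<Phi> 1 - \<Phi> 0 \<le> I"
  defines "S \<equiv> cmod (u 0) + cmod (v 0)" and "\<kappa> \<equiv> \<bar>Re k\<bar>"
  shows "cmod (u 1 - exp k * u 0) \<le> 2 * exp (2 * I) * I * exp \<kappa> * S"
    and "cmod (u 1) + cmod (v 1) \<le> 2 * exp (2 * I) * exp \<kappa> * S"
proof -
  define n where "n = (\<lambda>t. (cmod (u t))\<^sup>2 + (cmod (v t))\<^sup>2)"
  define n' where "n' = (\<lambda>t. 2 * (u t \<bullet> (k * u t + E1 t)) + 2 * (v t \<bullet> (- k * v t + E2 t)))"
  have n_deriv: "(n has_vector_derivative n' t) (at t within {0..1})" if "t \<in> {0..1}" for t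
    unfolding n_def n'_def power2_norm_eq_inner
    using has_vector_derivative_add[OF
        bounded_bilinear.has_vector_derivative[OF bounded_bilinear_inner u[OF that] u[OF that]]
        bounded_bilinear.has_vector_derivative[OF bounded_bilinear_inner v[OF that] v[OF that]]]
    by (simp add: inner_commute)
  have inner_mult: "w \<bullet> (l * w) = Re l * (cmod w)\<^sup>2" for w l :: complex
    unfolding cmod_power2 inner_complex_def by (simp add: power2_eq_square algebra_simps)
  have n'_le: "n' t \<le> (2 * \<kappa> + 4 * \<epsilon> t) * n t" if t: "t \<in> {0..1}" for t
  proof -
    define A B where "A = cmod (u t)" and "B = cmod (v t)"
    define X P Y D where "X = Re k * A\<^sup>2 + - Re k * B\<^sup>2" and "P = \<kappa> * A\<^sup>2 + \<kappa> * B\<^sup>2"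
      and "Y = \<epsilon> t * (A + B)" and "D = \<epsilon> t * (2 * (A\<^sup>2 + B\<^sup>2))"
    have "X \<le> P" unfolding X_def P_def
      by (intro add_mono mult_right_mono) (auto simp: \<kappa>_def)
    moreover have "u t \<bullet> E1 t \<le> A * Y"
      using norm_cauchy_schwarz[of "u t" "E1 t"] mult_left_mono[OF E1[OF t], of A] by (simp add: A_def B_def Y_def)
    moreover have "v t \<bullet> E2 t \<le> B * Y"
      using norm_cauchy_schwarz[of "v t" "E2 t"] mult_left_mono[OF E2[OF t], of B] by (simp add: A_def B_def Y_def)
    moreover have "A * Y + B * Y \<le> D"
    proof -
      have "A * Y + B * Y = \<epsilon> t * (A + B)\<^sup>2" by (simp add: Y_def power2_eq_square algebra_simps)
      also have "\<dots> \<le> D" unfolding D_def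
        using \<epsilon>0[OF t] sum_squares_ge_zero[of "A - B" 0]
        by (intro mult_left_mono) (auto simp: power2_eq_square algebra_simps)
      finally show ?thesis .
    qed
    ultimately have "2 * X + 2 * (u t \<bullet> E1 t + v t \<bullet> E2 t) \<le> 2 * P + 2 * D" by argo
    also have "2 * X + 2 * (u t \<bullet> E1 t + v t \<bullet> E2 t) = n' t"
      unfolding n'_def inner_add_right inner_mult X_def by (simp add: A_def B_def algebra_simps)
    also have "2 * P + 2 * D = (2 * \<kappa> + 4 * \<epsilon> t) * n t"
      by (simp add: n_def A_def B_def P_def D_def algebra_simps)
    finally show ?thesis .
  qed
  define \<theta> where "\<theta> = (\<lambda>t. 2 * \<kappa> * t + 4 * \<Phi> t)"
  have \<theta>_deriv: "(\<theta> has_vector_derivative (2 * \<kappa> + 4 * \<epsilon> t)) (at t within {0..1})" if "t \<in> {0..1}" for t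
    unfolding \<theta>_def using \<Phi>[OF that] by (auto intro!: derivative_eq_intros)
  have sum_le: "cmod (u t) + cmod (v t) \<le> 2 * exp (2 * I) * exp (\<kappa> * t) * S" if t: "t \<in> {0..1}" for t
  proof -
    have "- (n 0 * exp (- \<theta> 0)) \<le> - (n t * exp (- \<theta> t))"
    proof (rule le_of_nonneg_vector_derivative[where \<phi> = "\<lambda>r. - (n r * exp (- \<theta> r))"])
      show "0 \<le> t" using t by simp
      fix r assume "r \<in> {0..t}"
      then have r: "r \<in> {0..1}" using t by simp
      show "((\<lambda>r. - (n r * exp (- \<theta> r))) has_vector_derivative
          (2 * \<kappa> + 4 * \<epsilon> r) * n r * exp (- \<theta> r) - n' r * exp (- \<theta> r)) (at r within {0..t})"
      proof -
        have "{0..t} \<subseteq> {0..1}" using t by auto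
        then have dn: "(n has_real_derivative n' r) (at r within {0..t})"
          and d\<theta>: "(\<theta> has_real_derivative (2 * \<kappa> + 4 * \<epsilon> r)) (at r within {0..t})"
          using n_deriv[OF r] \<theta>_deriv[OF r]
          unfolding has_real_derivative_iff_has_vector_derivative
          by (auto intro: has_vector_derivative_within_subset)
        have "((\<lambda>r. exp (- \<theta> r)) has_real_derivative - (2 * \<kappa> + 4 * \<epsilon> r) * exp (- \<theta> r)) (at r within {0..t})"
          by (rule DERIV_cong[OF DERIV_chain2[OF DERIV_exp DERIV_minus[OF d\<theta>]]]) simp
        from DERIV_minus[OF DERIV_mult[OF dn this]] show ?thesis
          unfolding has_real_derivative_iff_has_vector_derivative[symmetric]
          by (rule DERIV_cong) (simp add: algebra_simps)
      qed
      show "0 \<le> (2 * \<kappa> + 4 * \<epsilon> r) * n r * exp (- \<theta> r) - n' r * exp (- \<theta> r)"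
        using n'_le[OF r] by (simp add: mult_right_mono)
    qed
    then have "n t * exp (- \<theta> t) * exp (\<theta> t) \<le> n 0 * exp (- \<theta> 0) * exp (\<theta> t)" by (intro mult_right_mono) auto
    then have "n t \<le> n 0 * exp (\<theta> t - \<theta> 0)" by (simp add: exp_minus exp_diff field_simps)
    also have "\<dots> \<le> S\<^sup>2 * exp (2 * (\<kappa> * t + 2 * I))"
    proof (rule mult_mono)
      show "n 0 \<le> S\<^sup>2" by (simp add: n_def S_def power2_sum)
      have "\<Phi> t \<le> \<Phi> 1"
      proof (rule le_of_nonneg_vector_derivative[where \<phi> = \<Phi>])
        show "t \<le> 1" using t by simp
        fix r assume "r \<in> {t..1}"
        then have r: "r \<in> {0..1}" using t by simp
        show "(\<Phi> has_vector_derivative \<epsilon> r) (at r within {t..1})"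
          by (rule has_vector_derivative_within_subset[OF \<Phi>[OF r]]) (use t in auto)
        show "0 \<le> \<epsilon> r" by (rule \<epsilon>0[OF r])
      qed
      then show "exp (\<theta> t - \<theta> 0) \<le> exp (2 * (\<kappa> * t + 2 * I))" using I by (simp add: \<theta>_def)
    qed auto
    finally have "n t \<le> (S * exp (\<kappa> * t + 2 * I))\<^sup>2"
      unfolding power_mult_distrib exp_double[symmetric] .
    moreover have "(cmod (u t) + cmod (v t))\<^sup>2 \<le> 2 * n t"
      using sum_squares_ge_zero[of "cmod (u t) - cmod (v t)" 0]
      by (simp add: n_def power2_eq_square algebra_simps)
    moreover have "2 * (S * exp (\<kappa> * t + 2 * I))\<^sup>2 \<le> (2 * (S * exp (\<kappa> * t + 2 * I)))\<^sup>2"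
      by (simp add: power_mult_distrib)
    ultimately have "(cmod (u t) + cmod (v t))\<^sup>2 \<le> (2 * (S * exp (\<kappa> * t + 2 * I)))\<^sup>2" by linarith
    then have "cmod (u t) + cmod (v t) \<le> 2 * (S * exp (\<kappa> * t + 2 * I))"
      by (rule power2_le_imp_le) (simp add: S_def)
    then show ?thesis by (simp add: exp_add mult_ac)
  qed
  from sum_le[of 1] show "cmod (u 1) + cmod (v 1) \<le> 2 * exp (2 * I) * exp \<kappa> * S" by simp
  \<comment> \<open>Variation of constants: \<open>w\<close> joins \<open>exp k * u 0\<close> to \<open>u 1\<close>, and its derivative contains only the error.\<close>
  define w where "w = (\<lambda>t::real. exp (k * (1 - of_real t)) * u t)"
  have "cmod (w 1 - w 0) \<le> (2 * exp (2 * I) * exp \<kappa> * S) * \<Phi> 1 - (2 * exp (2 * I) * exp \<kappa> * S) * \<Phi> 0"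
  proof (rule norm_increment_le)
    fix t :: real assume t: "t \<in> {0..1}"
    have "((\<lambda>t::real. exp (k * (1 - of_real t))) has_vector_derivative - k * exp (k * (1 - of_real t))) (at t within {0..1})"
      by (rule has_vector_derivative_real_field) (auto intro!: derivative_eq_intros)
    from has_vector_derivative_mult[OF this u[OF t]]
    show "(w has_vector_derivative exp (k * (1 - of_real t)) * E1 t) (at t within {0..1})"
      by (simp add: w_def algebra_simps)
    show "((\<lambda>t. (2 * exp (2 * I) * exp \<kappa> * S) * \<Phi> t) has_vector_derivative (2 * exp (2 * I) * exp \<kappa> * S) * \<epsilon> t) (at t within {0..1})"
      using \<Phi>[OF t] by (rule has_vector_derivative_mult_right)
    have "Re k * (1 - t) \<le> \<kappa> * (1 - t)" using t by (intro mult_right_mono) (auto simp: \<kappa>_def)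
    then have "cmod (exp (k * (1 - of_real t))) \<le> exp (\<kappa> * (1 - t))" by simp
    moreover have "cmod (E1 t) \<le> \<epsilon> t * (2 * exp (2 * I) * exp (\<kappa> * t) * S)"
      using E1[OF t] mult_left_mono[OF sum_le[OF t] \<epsilon>0[OF t]] by (rule order_trans)
    ultimately have "cmod (exp (k * (1 - of_real t)) * E1 t)
        \<le> exp (\<kappa> * (1 - t)) * (\<epsilon> t * (2 * exp (2 * I) * exp (\<kappa> * t) * S))"
      unfolding norm_mult by (intro mult_mono) auto
    also have "\<dots> = (2 * exp (2 * I) * (exp (\<kappa> * (1 - t)) * exp (\<kappa> * t)) * S) * \<epsilon> t"
      by (simp add: mult_ac)
    also have "exp (\<kappa> * (1 - t)) * exp (\<kappa> * t) = exp \<kappa>"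
      unfolding exp_add[symmetric] by (simp add: algebra_simps)
    finally show "cmod (exp (k * (1 - of_real t)) * E1 t) \<le> (2 * exp (2 * I) * exp \<kappa> * S) * \<epsilon> t" .
  qed simp
  also have "\<dots> = (2 * exp (2 * I) * exp \<kappa> * S) * (\<Phi> 1 - \<Phi> 0)" by (simp add: algebra_simps)
  also have "\<dots> \<le> (2 * exp (2 * I) * exp \<kappa> * S) * I"
    using I by (intro mult_left_mono) (auto simp: S_def)
  finally show "cmod (u 1 - exp k * u 0) \<le> 2 * exp (2 * I) * I * exp \<kappa> * S"
    by (simp add: w_def mult_ac)
qed

text \<open>
  The gauge transformation with averages over windows of length \<open>\<bar>z\<bar>\<^sup>-\<^sup>2\<close> produces a diagonal system
  with an error whose integral is at most \<open>12 R\<^sup>3 / \<bar>z\<bar>\<close>. The condition \<open>4 R \<le> \<bar>z\<bar>\<close>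
  makes the transformation invertible with bounded inverse. The constant 57 collects \<open>48\<close> from the
  diagonal system, and \<open>8 + 1\<close> from undoing the transformation at the two ends.
\<close>

lemma column_asymptotics:
  fixes x1 x2 x3 x4 a c :: "real \<Rightarrow> complex" and s z k :: complex
  assumes R: "1 \<le> R" and z: "4 * R \<le> cmod z" and s: "s\<^sup>2 = 1" and k: "k = - 2 * \<i> * s * z\<^sup>2"
    and G: "variation_majorant x1 G" "variation_majorant x2 G" "variation_majorant x3 G"
      "variation_majorant x4 G" "G 1 - G 0 \<le> R"
    and x: "\<And>t. t \<in> {0..1} \<Longrightarrow> cmod (x1 t) \<le> R" "\<And>t. t \<in> {0..1} \<Longrightarrow> cmod (x2 t) \<le> R"
      "\<And>t. t \<in> {0..1} \<Longrightarrow> cmod (x3 t) \<le> R" "\<And>t. t \<in> {0..1} \<Longrightarrow> cmod (x4 t) \<le> R"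
    and a: "\<And>t. t \<in> {0..1} \<Longrightarrow> (a has_vector_derivative
        ((k - \<i> * s * x1 t * x2 t) * a t + (2 * z * x1 t + \<i> * x3 t) * c t)) (at t within {0..1})"
    and c: "\<And>t. t \<in> {0..1} \<Longrightarrow> (c has_vector_derivative
        ((2 * z * x2 t - \<i> * x4 t) * a t - (k - \<i> * s * x1 t * x2 t) * c t)) (at t within {0..1})"
  shows "cmod (a 1 - exp k * a 0)
    \<le> 57 * R ^ 3 * exp (24 * R ^ 3) / cmod z * exp \<bar>Re k\<bar> * (cmod (a 0) + cmod (c 0))"
proof -
  have z1: "1 \<le> cmod z" using R z by linarith
  have zpos: "0 < cmod z" using z1 by linarith
  have z0: "z \<noteq> 0" using zpos by auto
  have s1: "cmod s = 1" using s by (auto simp: power2_eq_1_iff)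
  have s0: "s \<noteq> 0" using s1 by auto
  have k0: "k \<noteq> 0" using z0 s0 by (simp add: k)
  \<comment> \<open>The window length balances the two errors caused by averaging.\<close>
  define h where "h = 1 / (cmod z)\<^sup>2"
  have h: "h > 0" using zpos by (simp add: h_def)
  define g where "g = modulus_increment G h"
  obtain q1 q1' where q1: "\<And>t. t \<in> {0..1} \<Longrightarrow> (q1 has_vector_derivative q1' t) (at t within {0..1})"
    "\<And>t. t \<in> {0..1} \<Longrightarrow> cmod (q1 t - x1 t) \<le> g t"
    "\<And>t. t \<in> {0..1} \<Longrightarrow> cmod (q1' t) \<le> g t / h" "\<And>t. t \<in> {0..1} \<Longrightarrow> cmod (q1 t) \<le> R"
    using steklov_average[OF G(1) h x(1)] unfolding g_def by metis
  obtain q2 q2' where q2: "\<And>t. t \<in> {0..1} \<Longrightarrow> (q2 has_vector_derivative q2' t) (at t within {0..1})"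
    "\<And>t. t \<in> {0..1} \<Longrightarrow> cmod (q2 t - x2 t) \<le> g t"
    "\<And>t. t \<in> {0..1} \<Longrightarrow> cmod (q2' t) \<le> g t / h" "\<And>t. t \<in> {0..1} \<Longrightarrow> cmod (q2 t) \<le> R"
    using steklov_average[OF G(2) h x(2)] unfolding g_def by metis
  obtain q3 q3' where q3: "\<And>t. t \<in> {0..1} \<Longrightarrow> (q3 has_vector_derivative q3' t) (at t within {0..1})"
    "\<And>t. t \<in> {0..1} \<Longrightarrow> cmod (q3 t - x3 t) \<le> g t"
    "\<And>t. t \<in> {0..1} \<Longrightarrow> cmod (q3' t) \<le> g t / h" "\<And>t. t \<in> {0..1} \<Longrightarrow> cmod (q3 t) \<le> R"
    using steklov_average[OF G(3) h x(3)] unfolding g_def by metis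
  have x4': "cmod (- x4 t) \<le> R" if "t \<in> {0..1}" for t using x(4)[OF that] by simp
  obtain q4 q4' where q4: "\<And>t. t \<in> {0..1} \<Longrightarrow> (q4 has_vector_derivative q4' t) (at t within {0..1})"
    "\<And>t. t \<in> {0..1} \<Longrightarrow> cmod (q4 t - (- x4 t)) \<le> g t"
    "\<And>t. t \<in> {0..1} \<Longrightarrow> cmod (q4' t) \<le> g t / h" "\<And>t. t \<in> {0..1} \<Longrightarrow> cmod (q4 t) \<le> R"
    using steklov_average[OF variation_majorant_uminus[OF G(4)] h x4'] unfolding g_def by metis
  obtain \<Phi> where \<Phi>: "\<And>t. t \<in> {0..1} \<Longrightarrow> (\<Phi> has_vector_derivative g t) (at t within {0..1})"
    "\<Phi> 1 - \<Phi> 0 \<le> h * (G 1 - G 0)"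
    using modulus_increment_primitive[OF G(1) h] unfolding g_def by metis
  have g_div: "g t / h = g t * (cmod z)\<^sup>2" for t by (simp add: h_def)
  have g0: "0 \<le> g t" if "t \<in> {0..1}" for t using q1(2)[OF that] norm_ge_zero order_trans by blast
  define p p' r r' where "p = (\<lambda>t. (2 * z * q1 t + \<i> * q3 t) / (2 * k))"
    and "p' = (\<lambda>t. (2 * z * q1' t + \<i> * q3' t) / (2 * k))"
    and "r = (\<lambda>t. (2 * z * q2 t + \<i> * q4 t) / (2 * - k))"
    and "r' = (\<lambda>t. (2 * z * q2' t + \<i> * q4' t) / (2 * - k))"
  have p_deriv: "(p has_vector_derivative p' t) (at t within {0..1})"
    and r_deriv: "(r has_vector_derivative r' t) (at t within {0..1})" if "t \<in> {0..1}" for t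
    unfolding p_def p'_def r_def r'_def
    by (intro has_vector_derivative_divide has_vector_derivative_add has_vector_derivative_mult_right
        q1 q2 q3 q4 that)+
  have p_eq: "2 * k * p t = 2 * z * q1 t + \<i> * q3 t" "2 * k * p' t = 2 * z * q1' t + \<i> * q3' t"
    and r_eq: "2 * (- k) * r t = 2 * z * q2 t + \<i> * q4 t" "2 * (- k) * r' t = 2 * z * q2' t + \<i> * q4' t" for t
    using k0 by (simp_all add: p_def p'_def r_def r'_def)
  have ms: "(- s)\<^sup>2 = 1" "cmod (- s) = 1" "- k = - 2 * \<i> * (- s) * z\<^sup>2" using s s1 by (simp_all add: k)
  have Rz: "R / cmod z \<le> 1/4" using z zpos by (simp add: field_simps)
  have p_le: "cmod (p t) \<le> R / cmod z" if "t \<in> {0..1}" for t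
    by (rule gauge_factor_bound[OF z1 s1 k p_eq(1) q1(4)[OF that] q3(4)[OF that]])
  have r_le: "cmod (r t) \<le> R / cmod z" if "t \<in> {0..1}" for t
    by (rule gauge_factor_bound[OF z1 ms(2,3) r_eq(1) q2(4)[OF that] q4(4)[OF that]])
  define u v where "u = (\<lambda>t. a t + p t * c t)" and "v = (\<lambda>t. c t + r t * a t)"
  define a' c' where "a' = (\<lambda>t. (k - \<i> * s * x1 t * x2 t) * a t + (2 * z * x1 t + \<i> * x3 t) * c t)"
    and "c' = (\<lambda>t. (2 * z * x2 t - \<i> * x4 t) * a t - (k - \<i> * s * x1 t * x2 t) * c t)"
  define E1 E2 where "E1 = (\<lambda>t. a' t + p' t * c t + p t * c' t - k * u t)"
    and "E2 = (\<lambda>t. c' t + r' t * a t + r t * a' t - (- k) * v t)"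
  define \<epsilon> where "\<epsilon> = (\<lambda>t. 2 * (4 * R * cmod z * g t + 2 * R ^ 3 / cmod z))"
  define I where "I = 12 * R ^ 3 / cmod z"
  have uv: "cmod (a t) + cmod (c t) \<le> 2 * (cmod (u t) + cmod (v t))"
    "cmod (u t) + cmod (v t) \<le> 2 * (cmod (a t) + cmod (c t))" if "t \<in> {0..1}" for t
    unfolding u_def v_def using p_le[OF that] r_le[OF that] Rz
    by (intro gauge_norm_equivalence; linarith)+
  have \<epsilon>0: "0 \<le> \<epsilon> t" if "t \<in> {0..1}" for t using g0[OF that] R by (simp add: \<epsilon>_def)
  have scale: "(4 * R * cmod z * g t + 2 * R ^ 3 / cmod z) * (cmod (a t) + cmod (c t))
      \<le> \<epsilon> t * (cmod (u t) + cmod (v t))" if "t \<in> {0..1}" for t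
  proof -
    have nonneg: "0 \<le> 4 * R * cmod z * g t + 2 * R ^ 3 / cmod z" using g0[OF that] R by simp
    have \<epsilon>: "\<epsilon> t * y = (4 * R * cmod z * g t + 2 * R ^ 3 / cmod z) * (2 * y)" for y
      by (simp add: \<epsilon>_def)
    show ?thesis unfolding \<epsilon> by (rule mult_left_mono[OF uv(1)[OF that] nonneg])
  qed
  have u_deriv: "(u has_vector_derivative (k * u t + E1 t)) (at t within {0..1})" if t: "t \<in> {0..1}" for t
  proof -
    have "k * u t + E1 t = a' t + (p t * c' t + p' t * c t)" by (simp add: E1_def)
    then show ?thesis
      using has_vector_derivative_add[OF a[OF t] has_vector_derivative_mult[OF p_deriv[OF t] c[OF t]]]
      by (simp only: u_def a'_def c'_def)
  qed
  have v_deriv: "(v has_vector_derivative (- k * v t + E2 t)) (at t within {0..1})" if t: "t \<in> {0..1}" for t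
  proof -
    have "- k * v t + E2 t = c' t + (r t * a' t + r' t * a t)" by (simp add: E2_def)
    then show ?thesis
      using has_vector_derivative_add[OF c[OF t] has_vector_derivative_mult[OF r_deriv[OF t] a[OF t]]]
      by (simp only: v_def a'_def c'_def)
  qed
  have E1_le: "cmod (E1 t) \<le> \<epsilon> t * (cmod (u t) + cmod (v t))" if t: "t \<in> {0..1}" for t
  proof -
    have "cmod (E1 t) \<le> (4 * R * cmod z * g t + 2 * R ^ 3 / cmod z) * (cmod (a t) + cmod (c t))"
      unfolding E1_def a'_def c'_def u_def
      by (rule gauge_defect_bound[OF z1 s k p_eq R])
        (use x q1 q3 t in \<open>auto simp: g_div\<close>)
    then show ?thesis using scale[OF t] by (rule order_trans)
  qed
  have E2_le: "cmod (E2 t) \<le> \<epsilon> t * (cmod (u t) + cmod (v t))" if t: "t \<in> {0..1}" for t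
  proof -
    have "cmod (((- k - \<i> * (- s) * x2 t * x1 t) * c t + (2 * z * x2 t + \<i> * (- x4 t)) * a t) + r' t * a t
        + r t * ((2 * z * x1 t - \<i> * (- x3 t)) * c t - (- k - \<i> * (- s) * x2 t * x1 t) * a t)
        - (- k) * (c t + r t * a t))
        \<le> (4 * R * cmod z * g t + 2 * R ^ 3 / cmod z) * (cmod (c t) + cmod (a t))"
      by (rule gauge_defect_bound[OF z1 ms(1) ms(3) r_eq R])
        (use x q2 q4 t in \<open>auto simp: g_div\<close>)
    also have "((- k - \<i> * (- s) * x2 t * x1 t) * c t + (2 * z * x2 t + \<i> * (- x4 t)) * a t) + r' t * a t
        + r t * ((2 * z * x1 t - \<i> * (- x3 t)) * c t - (- k - \<i> * (- s) * x2 t * x1 t) * a t)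
        - (- k) * (c t + r t * a t) = E2 t"
      unfolding E2_def a'_def c'_def v_def by (simp add: algebra_simps)
    finally show ?thesis using scale[OF t] by (simp add: add.commute)
  qed
  have R23: "R\<^sup>2 \<le> R ^ 3" using R by (auto intro: power_increasing)
  \<comment> \<open>The integral of the error rate \<open>\<epsilon>\<close>, of order \<open>1 / \<bar>z\<bar>\<close>.\<close>
  define \<Psi> where "\<Psi> = (\<lambda>t. (8 * R * cmod z) * \<Phi> t + (4 * R ^ 3 / cmod z) * t)"
  have \<Psi>_deriv: "(\<Psi> has_vector_derivative \<epsilon> t) (at t within {0..1})" if t: "t \<in> {0..1}" for t
  proof -
    have "(\<Psi> has_vector_derivative (8 * R * cmod z) * g t + (4 * R ^ 3 / cmod z) * 1) (at t within {0..1})"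
      unfolding \<Psi>_def
      by (intro has_vector_derivative_add has_vector_derivative_mult_right \<Phi>(1) t has_vector_derivative_id)
    then show ?thesis by (simp add: \<epsilon>_def mult_ac)
  qed
  have \<Psi>_le: "\<Psi> 1 - \<Psi> 0 \<le> I"
  proof -
    have "h * (G 1 - G 0) \<le> h * R" using G(5) h by (intro mult_left_mono) auto
    then have "\<Phi> 1 - \<Phi> 0 \<le> h * R" using \<Phi>(2) by linarith
    then have "(8 * R * cmod z) * (\<Phi> 1 - \<Phi> 0) \<le> (8 * R * cmod z) * (h * R)"
      using R by (intro mult_left_mono) auto
    also have "\<dots> = 8 * (R\<^sup>2 / cmod z)" using z0 by (simp add: h_def power2_eq_square)
    also have "\<dots> \<le> 8 * (R ^ 3 / cmod z)" using R23 zpos by (intro mult_left_mono divide_right_mono) auto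
    finally show ?thesis by (simp add: \<Psi>_def I_def algebra_simps)
  qed
  define \<kappa> where "\<kappa> = \<bar>Re k\<bar>"
  define S where "S = cmod (a 0) + cmod (c 0)"
  define e where "e = exp (24 * R ^ 3)"
  have S0: "0 \<le> S" by (simp add: S_def)
  have e1: "1 \<le> e" using R by (simp add: e_def)
  have I0: "0 \<le> I" using R by (simp add: I_def)
  have "I \<le> 12 * R ^ 3" using R z1 zpos by (simp add: I_def divide_le_eq)
  then have eI: "exp (2 * I) \<le> e" by (simp add: e_def)
  have uv0: "cmod (u 0) + cmod (v 0) \<le> 2 * S" unfolding S_def by (rule uv(2)) simp
  note pert = diagonal_perturbation[OF u_deriv v_deriv E1_le E2_le \<Psi>_deriv \<epsilon>0 \<Psi>_le]
  have 1: "cmod (u 1 - exp k * u 0) \<le> 48 * (R ^ 3 * e / cmod z * exp \<kappa> * S)"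
  proof -
    have "cmod (u 1 - exp k * u 0) \<le> 2 * exp (2 * I) * I * exp \<kappa> * (cmod (u 0) + cmod (v 0))"
      unfolding \<kappa>_def by (rule pert(1))
    also have "\<dots> \<le> 2 * e * I * exp \<kappa> * (2 * S)"
      using eI I0 uv0 S0 e1 by (intro mult_mono mult_nonneg_nonneg) auto
    finally show ?thesis by (simp add: I_def mult_ac)
  qed
  have 2: "cmod (c 1) \<le> 8 * (e * exp \<kappa> * S)"
  proof -
    have "cmod (u 1) + cmod (v 1) \<le> 2 * exp (2 * I) * exp \<kappa> * (cmod (u 0) + cmod (v 0))"
      unfolding \<kappa>_def by (rule pert(2))
    also have "\<dots> \<le> 2 * e * exp \<kappa> * (2 * S)"
      using eI uv0 S0 e1 by (intro mult_mono mult_nonneg_nonneg) auto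
    finally have "cmod (u 1) + cmod (v 1) \<le> 4 * (e * exp \<kappa> * S)" by simp
    then have "2 * (cmod (u 1) + cmod (v 1)) \<le> 8 * (e * exp \<kappa> * S)" by simp
    moreover have "cmod (c 1) \<le> cmod (a 1) + cmod (c 1)" by simp
    moreover have "cmod (a 1) + cmod (c 1) \<le> 2 * (cmod (u 1) + cmod (v 1))" by (rule uv(1)) simp
    ultimately show ?thesis by (meson order_trans)
  qed
  have "R / cmod z * 1 \<le> R / cmod z * (R\<^sup>2)" using R by (intro mult_left_mono) auto
  then have RR: "R / cmod z \<le> R ^ 3 / cmod z" by (simp add: power2_eq_square power3_eq_cube)
  have 3: "cmod (p 1 * c 1) \<le> 8 * (R ^ 3 * e / cmod z * exp \<kappa> * S)"
  proof -
    have "cmod (p 1 * c 1) \<le> R ^ 3 / cmod z * (8 * (e * exp \<kappa> * S))"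
      unfolding norm_mult using p_le[of 1] RR 2 R by (intro mult_mono) auto
    then show ?thesis by (simp add: mult_ac)
  qed
  have 4: "cmod (exp k * (p 0 * c 0)) \<le> R ^ 3 * e / cmod z * exp \<kappa> * S"
  proof -
    have "cmod (exp k * (p 0 * c 0)) \<le> exp \<kappa> * (R ^ 3 / cmod z * S)"
      unfolding norm_mult using p_le[of 0] RR R
      by (intro mult_mono) (auto simp: \<kappa>_def S_def)
    also have "\<dots> \<le> e * (exp \<kappa> * (R ^ 3 / cmod z * S))"
      using mult_right_mono[OF e1, of "exp \<kappa> * (R ^ 3 / cmod z * S)"] R S0 by simp
    finally show ?thesis by (simp add: mult_ac)
  qed
  have eq: "a 1 - exp k * a 0 = (u 1 - exp k * u 0) - p 1 * c 1 + exp k * (p 0 * c 0)"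
    by (simp add: u_def algebra_simps)
  have "cmod (a 1 - exp k * a 0)
      \<le> cmod (u 1 - exp k * u 0) + cmod (p 1 * c 1) + cmod (exp k * (p 0 * c 0))"
    unfolding eq
    by (intro order_trans[OF norm_triangle_ineq] add_right_mono norm_triangle_ineq4)
  also have "\<dots> \<le> 57 * (R ^ 3 * e / cmod z * exp \<kappa> * S)" 
  proof -
    have "x + y + w \<le> 57 * T" if "x \<le> 48 * T" "y \<le> 8 * T" "w \<le> T" for x y w T :: real
      using that by linarith
    then show ?thesis using 1 3 4 by blast
  qed
  finally show ?thesis by (simp add: e_def \<kappa>_def S_def mult_ac)
qed

section \<open>Asymptotics of the discriminant\<close>

definition coefficient_matrix :: "(real \<Rightarrow> complex) ^ 4 \<Rightarrow> complex \<Rightarrow> real \<Rightarrow> complex ^ 2 ^ 2" where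
  "coefficient_matrix \<psi> z t = mat (- 2 * \<i> * z\<^sup>2) ** sigma3 + V_mat z \<psi> t"

lemma coefficient_matrix_nth:
  "coefficient_matrix \<psi> z t $ 1 $ 1 = - 2 * \<i> * z\<^sup>2 - \<i> * (\<psi> $ 1) t * (\<psi> $ 2) t"
  "coefficient_matrix \<psi> z t $ 1 $ 2 = 2 * z * (\<psi> $ 1) t + \<i> * (\<psi> $ 3) t"
  "coefficient_matrix \<psi> z t $ 2 $ 1 = 2 * z * (\<psi> $ 2) t - \<i> * (\<psi> $ 4) t"
  "coefficient_matrix \<psi> z t $ 2 $ 2 = 2 * \<i> * z\<^sup>2 + \<i> * (\<psi> $ 1) t * (\<psi> $ 2) t"
  by (simp_all add: coefficient_matrix_def sigma3_def V_mat_def matrix_matrix_mult_def mat_def sum_2 algebra_simps)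

text \<open>
  With this, \<open>holomorphic_picard_series\<close> applies to the spectral problem.
\<close>

lemma polynomial_family_coefficient_matrix:
  fixes \<psi> :: "(real \<Rightarrow> complex) ^ 4"
  assumes "\<And>j. continuous_on UNIV (\<psi> $ j)"
  shows "polynomial_family (\<lambda>z t. coefficient_matrix \<psi> z t $ i $ j)"
proof -
  have var: "polynomial_family (\<lambda>z t. z)"
    using polynomial_family.mult_var[OF polynomial_family.const[of "\<lambda>_. 1"]] by simp
  have const: "polynomial_family (\<lambda>z t. c)" for c by (rule polynomial_family.const) simp
  have psi: "polynomial_family (\<lambda>z t. (\<psi> $ j) t)" for j
    using polynomial_family.const[OF assms[of j]] by simp
  have diff: "polynomial_family (\<lambda>z t. f z t - g z t)" if "polynomial_family f" "polynomial_family g" for f g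
    using polynomial_family.add[OF that(1) polynomial_family_mult[OF const[of "-1"] that(2)]] by simp
  note fam = polynomial_family.add diff polynomial_family_mult const psi var
  have "polynomial_family (\<lambda>z t. coefficient_matrix \<psi> z t $ 1 $ 1)"
    "polynomial_family (\<lambda>z t. coefficient_matrix \<psi> z t $ 1 $ 2)"
    "polynomial_family (\<lambda>z t. coefficient_matrix \<psi> z t $ 2 $ 1)"
    "polynomial_family (\<lambda>z t. coefficient_matrix \<psi> z t $ 2 $ 2)"
    unfolding coefficient_matrix_nth power2_eq_square by (intro fam)+
  then show ?thesis
    using exhaust_2[of i] exhaust_2[of j] by auto
qed

lemma fundamental_solution_eq_picard_series:
  fixes \<psi> :: "(real \<Rightarrow> complex) ^ 4"
  assumes "\<And>j. continuous_on UNIV (\<psi> $ j)"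
  shows "is_fundamental_solution z \<psi> (\<lambda>t. fundamental_solution t z \<psi>)"
    and "fundamental_solution t z \<psi> = (\<Sum>n. picard_term (**) (coefficient_matrix \<psi> z) (mat 1) n t)"
proof -
  let ?A = "coefficient_matrix \<psi> z"
  define M where "M = (\<lambda>t. \<Sum>n. picard_term (**) ?A (mat 1 :: complex^2^2) n t)"
  have cont: "continuous_on UNIV ?A"
    by (rule continuous_on_matrix_family[OF polynomial_family_coefficient_matrix[OF assms]])
  have iff: "is_fundamental_solution z \<psi> M' \<longleftrightarrow>
      M' 0 = mat 1 \<and> (\<forall>t. (M' has_vector_derivative ?A t ** M' t) (at t))" for M'
    by (simp add: is_fundamental_solution_def coefficient_matrix_def)
  have M: "is_fundamental_solution z \<psi> M"
    unfolding iff M_def using linear_ode_picard_solution[OF bounded_bilinear_matrix_mult cont] by blast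
  have "(THE M. is_fundamental_solution z \<psi> M) = M"
  proof (rule the_equality)
    show "is_fundamental_solution z \<psi> M" by (rule M)
    show "M' = M" if "is_fundamental_solution z \<psi> M'" for M'
      using that M unfolding iff
      by (intro linear_ode_unique[OF bounded_bilinear_matrix_mult cont]) auto
  qed
  then have "fundamental_solution t z \<psi> = M t" for t by (simp add: fundamental_solution_def)
  then show "is_fundamental_solution z \<psi> (\<lambda>t. fundamental_solution t z \<psi>)"
    "fundamental_solution t z \<psi> = (\<Sum>n. picard_term (**) ?A (mat 1) n t)"
    using M by (simp_all add: M_def)
qed

lemma holomorphic_discriminant:
  fixes \<psi> :: "(real \<Rightarrow> complex) ^ 4"
  assumes "\<And>j. continuous_on UNIV (\<psi> $ j)"
  shows "(\<lambda>z. discriminant z \<psi>) holomorphic_on UNIV"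
  unfolding discriminant_def trace_def fundamental_solution_eq_picard_series(2)[OF assms]
  by (intro holomorphic_intros holomorphic_picard_series polynomial_family_coefficient_matrix assms)

text \<open>
  The first diagonal entry is governed by the first column with sign \<open>s = 1\<close>, the second by the second
  column with its components exchanged, hence with \<open>s = -1\<close> and the exponent \<open>- k\<close>.
\<close>

lemma discriminant_asymptotics:
  fixes \<psi> :: "(real \<Rightarrow> complex) ^ 4"
  assumes cont: "\<And>j. continuous_on UNIV (\<psi> $ j)"
    and R: "1 \<le> R" and z: "4 * R \<le> cmod z"
    and G: "\<And>j. variation_majorant (\<psi> $ j) G" "G 1 - G 0 \<le> R"
    and \<psi>: "\<And>j t. t \<in> {0..1} \<Longrightarrow> cmod ((\<psi> $ j) t) \<le> R"
  shows "cmod (discriminant z \<psi> - 2 * cos (2 * z\<^sup>2))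
    \<le> 114 * R ^ 3 * exp (24 * R ^ 3) / cmod z * exp \<bar>Im (2 * z\<^sup>2)\<bar>"
proof -
  define M where "M = (\<lambda>t. fundamental_solution t z \<psi>)"
  define k where "k = - 2 * \<i> * z\<^sup>2"
  have M: "M 0 = mat 1" "\<And>t. (M has_vector_derivative (coefficient_matrix \<psi> z t ** M t)) (at t)"
    using fundamental_solution_eq_picard_series(1)[OF cont, of z]
    by (auto simp: M_def is_fundamental_solution_def coefficient_matrix_def)
  have entry: "((\<lambda>t. M t $ i $ j) has_vector_derivative
      (coefficient_matrix \<psi> z t $ i $ 1 * M t $ 1 $ j + coefficient_matrix \<psi> z t $ i $ 2 * M t $ 2 $ j)) (at t within {0..1})"
    for i j t
  proof -
    have "bounded_linear (\<lambda>A::complex^2^2. A $ i $ j)"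
      by (rule bounded_linear_compose[OF bounded_linear_vec_nth bounded_linear_vec_nth])
    from bounded_linear.has_vector_derivative[OF this M(2)[of t]]
    have "((\<lambda>t. M t $ i $ j) has_vector_derivative (coefficient_matrix \<psi> z t ** M t) $ i $ j) (at t within {0..1})"
      by (rule has_vector_derivative_at_within)
    moreover have "(coefficient_matrix \<psi> z t ** M t) $ i $ j
        = coefficient_matrix \<psi> z t $ i $ 1 * M t $ 1 $ j + coefficient_matrix \<psi> z t $ i $ 2 * M t $ 2 $ j"
      by (simp add: matrix_matrix_mult_def sum_2)
    ultimately show ?thesis by (simp only:)
  qed
  define K where "K = 57 * R ^ 3 * exp (24 * R ^ 3) / cmod z"
  have k: "k = - (\<i> * (2 * z\<^sup>2))" "- k = 2 * \<i> * z\<^sup>2" by (simp_all add: k_def)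
  have Re_k: "\<bar>Re k\<bar> = \<bar>Im (2 * z\<^sup>2)\<bar>" unfolding k(1) uminus_complex.sel Re_i_times by (simp only: minus_minus)
  have 1: "cmod (M 1 $ 1 $ 1 - exp k * M 0 $ 1 $ 1)
      \<le> K * exp \<bar>Re k\<bar> * (cmod (M 0 $ 1 $ 1) + cmod (M 0 $ 2 $ 1))"
    unfolding K_def
  proof (rule column_asymptotics[where s = 1 and ?x1.0 = "\<psi> $ 1" and ?x2.0 = "\<psi> $ 2" and ?x3.0 = "\<psi> $ 3"
        and ?x4.0 = "\<psi> $ 4" and G = G])
    show "((\<lambda>t. M t $ 1 $ 1) has_vector_derivative
        (k - \<i> * 1 * (\<psi> $ 1) t * (\<psi> $ 2) t) * M t $ 1 $ 1 + (2 * z * (\<psi> $ 1) t + \<i> * (\<psi> $ 3) t) * M t $ 2 $ 1)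
        (at t within {0..1})" for t
      using entry[of 1 1 t] unfolding coefficient_matrix_nth k_def mult_1_right .
    show "((\<lambda>t. M t $ 2 $ 1) has_vector_derivative
        (2 * z * (\<psi> $ 2) t - \<i> * (\<psi> $ 4) t) * M t $ 1 $ 1 - (k - \<i> * 1 * (\<psi> $ 1) t * (\<psi> $ 2) t) * M t $ 2 $ 1)
        (at t within {0..1})" for t
    proof -
      have "- (k - \<i> * 1 * (\<psi> $ 1) t * (\<psi> $ 2) t) = 2 * \<i> * z\<^sup>2 + \<i> * (\<psi> $ 1) t * (\<psi> $ 2) t"
        unfolding k(2)[symmetric] by simp
      then show ?thesis
        using entry[of 2 1 t] unfolding coefficient_matrix_nth
        by (simp only: diff_conv_add_uminus[of "_ * M t $ 1 $ 1"] minus_mult_left)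
    qed
  qed (use R z G \<psi> in \<open>auto simp: k_def\<close>)
  have 2: "cmod (M 1 $ 2 $ 2 - exp (- k) * M 0 $ 2 $ 2)
      \<le> K * exp \<bar>Re (- k)\<bar> * (cmod (M 0 $ 2 $ 2) + cmod (M 0 $ 1 $ 2))"
    unfolding K_def
  proof (rule column_asymptotics[where s = "-1" and ?x1.0 = "\<psi> $ 2" and ?x2.0 = "\<psi> $ 1"
        and ?x3.0 = "\<lambda>t. - (\<psi> $ 4) t" and ?x4.0 = "\<lambda>t. - (\<psi> $ 3) t" and G = G])
    show "((\<lambda>t. M t $ 2 $ 2) has_vector_derivative
        (- k - \<i> * (- 1) * (\<psi> $ 2) t * (\<psi> $ 1) t) * M t $ 2 $ 2 + (2 * z * (\<psi> $ 2) t + \<i> * (- (\<psi> $ 4) t)) * M t $ 1 $ 2)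
        (at t within {0..1})" for t
      using entry[of 2 2 t] unfolding coefficient_matrix_nth k(2)[symmetric]
      by (simp add: mult_ac add_ac)
    show "((\<lambda>t. M t $ 1 $ 2) has_vector_derivative
        (2 * z * (\<psi> $ 1) t - \<i> * (- (\<psi> $ 3) t)) * M t $ 2 $ 2 - (- k - \<i> * (- 1) * (\<psi> $ 2) t * (\<psi> $ 1) t) * M t $ 1 $ 2)
        (at t within {0..1})" for t
    proof -
      have "- (- k - \<i> * (- 1) * (\<psi> $ 2) t * (\<psi> $ 1) t) = - 2 * \<i> * z\<^sup>2 - \<i> * (\<psi> $ 1) t * (\<psi> $ 2) t"
        by (simp add: k_def)
      moreover have "2 * z * (\<psi> $ 1) t - \<i> * (- (\<psi> $ 3) t) = 2 * z * (\<psi> $ 1) t + \<i> * (\<psi> $ 3) t" by simp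
      ultimately show ?thesis
        using entry[of 1 2 t] unfolding coefficient_matrix_nth
        by (simp only: diff_conv_add_uminus[of "_ * M t $ 2 $ 2"] minus_mult_left add.commute)
    qed
  qed (use R z G \<psi> in \<open>auto simp: k_def variation_majorant_uminus\<close>)
  have cos: "2 * cos (2 * z\<^sup>2) = exp k + exp (- k)"
  proof -
    have "2 * ((A + B) / 2) = B + A" for A B :: complex by simp
    then show ?thesis unfolding cos_exp_eq k(1) minus_minus .
  qed
  have "discriminant z \<psi> = M 1 $ 1 $ 1 + M 1 $ 2 $ 2"
    unfolding discriminant_def trace_def M_def sum_2 ..
  then have "discriminant z \<psi> - 2 * cos (2 * z\<^sup>2) = (M 1 $ 1 $ 1 - exp k) + (M 1 $ 2 $ 2 - exp (- k))"
    unfolding cos by (simp only: add_diff_add)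
  then have "cmod (discriminant z \<psi> - 2 * cos (2 * z\<^sup>2)) \<le> cmod (M 1 $ 1 $ 1 - exp k) + cmod (M 1 $ 2 $ 2 - exp (- k))"
    by (simp only: norm_triangle_ineq)
  also have "\<dots> \<le> K * exp \<bar>Re k\<bar> + K * exp \<bar>Re k\<bar>"
    using 1 2 by (intro add_mono) (simp_all add: M(1) mat_def)
  also have "\<dots> = 114 * R ^ 3 * exp (24 * R ^ 3) / cmod z * exp \<bar>Re k\<bar>" by (simp add: K_def)
  finally show ?thesis unfolding Re_k .
qed

section \<open>The unperturbed characteristic function\<close>

text \<open>
  The distance 1/4 is chosen below \<open>\<pi>/4\<close>, so that the excluded neighbourhoods lie well inside
  the sets \<^term>\<open>U_set m\<close>.
\<close>

definition away_from_pi_multiples :: "complex \<Rightarrow> bool" where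
  "away_from_pi_multiples w \<longleftrightarrow> (\<forall>m::int. 1 / 4 \<le> cmod (w - of_real (of_int m * pi)))"

lemma sin_shift_pi_multiple: "\<bar>sin (x - of_int m * pi)\<bar> = \<bar>sin (x::real)\<bar>"
proof -
  have "sin (of_int m * pi) = 0" using sin_zero_iff_int2 by blast
  then have "(cos (of_int m * pi))\<^sup>2 = 1"
    using sin_cos_squared_add[of "of_int m * pi"] by simp
  then have "\<bar>cos (of_int m * pi)\<bar> = 1" unfolding power2_eq_1_iff by auto
  then show ?thesis using \<open>sin (of_int m * pi) = 0\<close> by (simp add: sin_diff abs_mult)
qed

text \<open>
  With \<open>w = x + \<i> y\<close> one has \<open>4 \<bar>sin w\<bar>\<^sup>2 = (exp y - exp (- y))\<^sup>2 + 4 sin\<^sup>2 x\<close>. If \<open>\<bar>y\<bar> \<ge> 1/8\<close> the first term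
  alone is comparable to \<open>exp (2 \<bar>y\<bar>)\<close>. Otherwise \<open>x\<close> has distance at least \<open>1/8\<close> from \<open>\<pi>\<int>\<close>
  and the second term suffices, since the exponential is bounded.
\<close>

lemma norm_sin_lower_bound:
  "\<exists>c>0. \<forall>w. away_from_pi_multiples w \<longrightarrow> c * exp \<bar>Im w\<bar> \<le> cmod (sin w)"
proof -
  have sin_pos: "sin (1/8 :: real) > 0"
    using pi_gt3 by (intro sin_gt_zero) auto
  define c where "c = min (1/10) (sin (1/8) / exp (1/8) :: real)"
  have "c > 0" using sin_pos by (simp add: c_def)
  moreover have "c * exp \<bar>Im w\<bar> \<le> cmod (sin w)" if "away_from_pi_multiples w" for w
  proof -
    define x y where "x = Re w" and "y = \<bar>Im w\<bar>"
    have "exp (2 * Im w) + inverse (exp (2 * Im w)) = exp (2 * y) + inverse (exp (2 * y))"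
      by (auto simp: y_def abs_if exp_minus)
    moreover have "(exp y - exp (-y))\<^sup>2 = exp (2 * y) + inverse (exp (2 * y)) - 2"
      by (simp add: power2_diff exp_minus exp_double power_inverse)
    ultimately have sq: "4 * (cmod (sin w))\<^sup>2 = (exp y - exp (-y))\<^sup>2 + 4 * (sin x)\<^sup>2"
      unfolding norm_sin_squared x_def[symmetric] by (simp add: cos_double_sin)
    show ?thesis
    proof (cases "y \<ge> 1/8")
      case True
      have "1 + 1/4 \<le> exp (1/4 :: real)" by (rule exp_ge_add_one_self)
      moreover have "exp (1/4) \<le> exp (2 * y)" using True by simp
      ultimately have "exp (2 * y) \<ge> 5/4" by linarith
      then have "exp y * exp y \<ge> 5/4" by (simp add: exp_double power2_eq_square)
      then have "exp (-y) \<le> 4/5 * exp y" by (simp add: exp_minus field_simps)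
      then have "(exp y / 5)\<^sup>2 \<le> (exp y - exp (-y))\<^sup>2" by (intro power_mono) auto
      also have "\<dots> \<le> 4 * (cmod (sin w))\<^sup>2" using sq by simp
      also have "\<dots> = (2 * cmod (sin w))\<^sup>2" by (simp add: power2_eq_square)
      finally have "exp y / 5 \<le> 2 * cmod (sin w)" by (rule power2_le_imp_le) simp
      moreover have "c * exp y \<le> 1/10 * exp y" unfolding c_def by (intro mult_right_mono min.cobounded1) auto
      ultimately show ?thesis by (fold y_def) linarith
    next
      case False
      define m where "m = round (x / pi)"
      define d where "d = \<bar>x - of_int m * pi\<bar>"
      have "\<bar>of_int m - x / pi\<bar> \<le> 1/2" unfolding m_def by (rule of_int_round_abs_le)
      then have "\<bar>of_int m - x / pi\<bar> * pi \<le> 1/2 * pi" by (intro mult_right_mono) auto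
      moreover have "\<bar>of_int m - x / pi\<bar> * pi = \<bar>(of_int m - x / pi) * pi\<bar>" by (simp add: abs_mult)
      moreover have "(of_int m - x / pi) * pi = of_int m * pi - x" by (simp add: left_diff_distrib)
      ultimately have d_le: "d \<le> pi / 2" 
        unfolding d_def by (simp only: abs_minus_commute[of x]) simp
      have "1/4 \<le> cmod (w - of_real (of_int m * pi))"
        using that by (simp add: away_from_pi_multiples_def)
      also have "\<dots> \<le> d + y"
        using cmod_le[of "w - of_real (of_int m * pi)"] by (simp add: d_def x_def y_def)
      finally have "1/8 \<le> d" using False by simp
      then have "sin (1/8) \<le> sin d" using d_le by (intro sin_monotone_2pi_le) auto
      also have "sin d \<le> \<bar>sin x\<bar>"
        unfolding sin_shift_pi_multiple[of x m, symmetric] d_def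
        using sin_minus[of "x - of_int m * pi"] by (auto simp: abs_if)
      also have "\<bar>sin x\<bar> \<le> cmod (sin w)"
      proof (rule power2_le_imp_le)
        show "\<bar>sin x\<bar>\<^sup>2 \<le> (cmod (sin w))\<^sup>2"
          unfolding power2_abs using sq zero_le_power2[of "exp y - exp (-y)"] by linarith
      qed simp
      finally have "sin (1/8) \<le> cmod (sin w)" .
      moreover have "c * exp y \<le> sin (1/8) / exp (1/8) * exp (1/8)"
        using False sin_pos by (intro mult_mono) (auto simp: c_def)
      ultimately show ?thesis by (simp add: y_def)
    qed
  qed
  ultimately show ?thesis by blast
qed

text \<open>
  The function \<open>\<Delta>\<^sup>2 - 4\<close> for the zero potential, where \<open>\<Delta> = 2 cos (2z\<^sup>2)\<close>.
\<close>

definition free_chi :: "complex \<Rightarrow> complex" where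
  "free_chi z = - 4 * (sin (2 * z\<^sup>2))\<^sup>2"

lemma holomorphic_free_chi: "free_chi holomorphic_on S"
  unfolding free_chi_def by (intro holomorphic_intros)

lemma free_chi_eq_0_iff: "free_chi z = 0 \<longleftrightarrow> (\<exists>m::int. 2 * z\<^sup>2 = of_real (of_int m * pi))"
  by (simp add: free_chi_def sin_eq_0)

lemma zorder_free_chi_eq_double:
  assumes "zorder (\<lambda>z. sin (2 * z\<^sup>2)) c = k"
  shows "zorder free_chi c = 2 * k"
proof -
  let ?s = "\<lambda>z::complex. sin (2 * z\<^sup>2)"
  have hol: "?s holomorphic_on UNIV" by (intro holomorphic_intros)
  have "\<exists>\<^sub>F z in at c. ?s z \<noteq> 0"
  proof (rule ccontr)
    assume "\<not> ?thesis"
    then have ev: "\<forall>\<^sub>F z in at c. ?s z = 0" by (simp add: frequently_def)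
    have lim: "c islimpt {z. ?s z = 0}"
      by (rule islimpt_conv_frequently_at[THEN iffD2])
        (use ev in \<open>auto intro: eventually_frequently\<close>)
    obtain w :: complex where "w\<^sup>2 = of_real (pi / 4)" using power2_csqrt by metis
    then have "2 * w\<^sup>2 = of_real (pi / 2)" by (simp add: mult.commute)
    moreover have "?s w = 0"
      by (rule analytic_continuation[OF hol _ _ _ _ lim]) auto
    ultimately show False by (simp only: sin_of_real) simp
  qed
  then have "zorder (\<lambda>z. (?s z)\<^sup>2) c = int 2 * zorder ?s c"
    by (intro zorder_power analytic_on_imp_meromorphic_on analytic_intros)
  then show ?thesis
    using assms zorder_cmult[of "-4" "\<lambda>z. (?s z)\<^sup>2" c] by (simp add: free_chi_def[abs_def])
qed

lemma deriv_sin_square: "deriv (\<lambda>z::complex. sin (2 * z\<^sup>2)) = (\<lambda>z. 4 * z * cos (2 * z\<^sup>2))"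
  by (rule ext, rule DERIV_imp_deriv) (auto intro!: derivative_eq_intros)

lemma zorder_free_chi_nonzero:
  assumes "c \<noteq> 0" "free_chi c = 0"
  shows "zorder free_chi c = 2"
proof -
  have "sin (2 * c\<^sup>2) = 0" using assms(2) by (simp add: free_chi_def)
  then have "cos (2 * c\<^sup>2) \<noteq> 0" using sin_cos_squared_add[of "2 * c\<^sup>2"] by auto
  have "zorder (\<lambda>z. sin (2 * z\<^sup>2)) c = 1"
    by (rule zorder_zero_eqI')
      (use assms(1) \<open>cos _ \<noteq> 0\<close> \<open>sin _ = 0\<close> in \<open>auto simp: deriv_sin_square intro!: analytic_intros\<close>)
  then show ?thesis using zorder_free_chi_eq_double by fastforce
qed

lemma zorder_free_chi_0: "zorder free_chi 0 = 4"
proof -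
  have "deriv (deriv (\<lambda>z::complex. sin (2 * z\<^sup>2))) 0 = 4"
    unfolding deriv_sin_square by (rule DERIV_imp_deriv) (auto intro!: derivative_eq_intros)
  then have "(deriv ^^ 2) (\<lambda>z::complex. sin (2 * z\<^sup>2)) 0 = 4" by (simp add: eval_nat_numeral)
  then have "zorder (\<lambda>z. sin (2 * z\<^sup>2)) 0 = 2"
    by (intro zorder_zero_eqI')
       (auto simp: less_2_cases_iff deriv_sin_square intro!: analytic_intros)
  then show ?thesis using zorder_free_chi_eq_double by fastforce
qed


lemma away_from_pi_multiplesI:
  assumes "1 / 4 \<le> cmod (w - of_real (of_int m * pi))" "cmod (w - of_real (of_int m * pi)) \<le> pi - 1 / 4"
  shows "away_from_pi_multiples w"
  unfolding away_from_pi_multiples_def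
proof
  fix k :: int
  show "1 / 4 \<le> cmod (w - of_real (of_int k * pi))"
  proof (cases "k = m")
    case False
    have "1 \<le> \<bar>of_int m - of_int k :: real\<bar>" using False by linarith
    then have "1 * pi \<le> \<bar>of_int m - of_int k\<bar> * pi" by (intro mult_right_mono) auto
    also have "\<dots> = cmod (of_real ((of_int m - of_int k) * pi))" by (simp only: norm_of_real abs_mult) simp
    also have "of_real ((of_int m - of_int k) * pi)
        = (w - of_real (of_int k * pi)) - (w - of_real (of_int m * pi))" by (simp add: algebra_simps)
    also have "cmod \<dots> \<le> cmod (w - of_real (of_int k * pi)) + cmod (w - of_real (of_int m * pi))"
      by (rule norm_triangle_ineq4)
    finally show ?thesis using assms(2) by simp
  qed (use assms in simp)
qed

section \<open>Root counting by the theorem of Rouche\<close>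

text \<open>
  The general theorem is applied in a slightly larger ball; the
  winding numbers of the circle are 1 inside and 0 outside, and no root lies on it.
\<close>

lemma Rouche_ball:
  assumes f: "f holomorphic_on UNIV" and g: "g holomorphic_on UNIV" and "r > 0"
    and less: "\<And>z. cmod (z - c) = r \<Longrightarrow> cmod (g z) < cmod (f z)"
  shows "finite {z \<in> ball c r. f z + g z = 0}"
    and "(\<Sum>z | z \<in> ball c r \<and> f z + g z = 0. zorder (\<lambda>z. f z + g z) z)
       = (\<Sum>z | z \<in> ball c r \<and> f z = 0. zorder f z)"
proof -
  define \<gamma> where "\<gamma> = circlepath c r"
  have fin: "finite {z \<in> cball c (r + 1). h z = 0}"
    if "h holomorphic_on UNIV" and nz: "\<And>z. cmod (z - c) = r \<Longrightarrow> h z \<noteq> 0" for h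
  proof (cases "h constant_on UNIV")
    case True
    have "h (c + of_real r) \<noteq> 0" by (rule nz) (use \<open>r > 0\<close> in simp)
    then have "h z \<noteq> 0" for z using True by (metis UNIV_I constant_on_def)
    then show ?thesis by simp
  next
    case False
    then show ?thesis
      using holomorphic_compact_finite_zeros[OF that(1), of "cball c (r + 1)"] by auto
  qed
  have f_nz: "f z \<noteq> 0" and fg_nz: "f z + g z \<noteq> 0" if "cmod (z - c) = r" for z
    using less[OF that] by (auto simp: add_eq_0_iff2)
  have fg: "(\<lambda>z. f z + g z) holomorphic_on UNIV"
    using f g by (rule holomorphic_on_add)
  have wn_in: "winding_number \<gamma> z = 1" if "z \<in> ball c r" for z
    unfolding \<gamma>_def using that by (intro winding_number_circlepath) (auto simp: dist_norm norm_minus_commute)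
  have wn_out: "winding_number \<gamma> z = 0" if "z \<notin> cball c r" for z
    unfolding \<gamma>_def using that \<open>r > 0\<close>
    by (intro winding_number_zero_outside[of _ "cball c r"]) (auto simp: dist_norm norm_minus_commute)
  have reduce: "(\<Sum>z | z \<in> ball c (r + 1) \<and> h z = 0. winding_number \<gamma> z * zorder h z)
      = of_int (\<Sum>z | z \<in> ball c r \<and> h z = 0. zorder h z)"
    if "finite {z \<in> ball c (r + 1). h z = 0}" and nz: "\<And>z. cmod (z - c) = r \<Longrightarrow> h z \<noteq> 0" for h
    unfolding of_int_sum
  proof (rule sum.mono_neutral_cong_right)
    show "\<forall>z\<in>{z. z \<in> ball c (r + 1) \<and> h z = 0} - {z. z \<in> ball c r \<and> h z = 0}.
             winding_number \<gamma> z * of_int (zorder h z) = 0"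
    proof
      fix z assume z: "z \<in> {z. z \<in> ball c (r + 1) \<and> h z = 0} - {z. z \<in> ball c r \<and> h z = 0}"
      then have "cmod (z - c) \<noteq> r" using nz by auto
      then have "z \<notin> cball c r" using z by (auto simp: dist_norm norm_minus_commute)
      then show "winding_number \<gamma> z * of_int (zorder h z) = 0" by (simp add: wn_out)
    qed
  qed (use that wn_in in auto)
  have fin': "finite {z \<in> ball c (r + 1). h z = 0}"
    if "h holomorphic_on UNIV" "\<And>z. cmod (z - c) = r \<Longrightarrow> h z \<noteq> 0" for h
    by (rule finite_subset[OF _ fin[OF that]]) auto
  have "(\<Sum>z\<in>{z \<in> ball c (r + 1). f z + g z = 0}. winding_number \<gamma> z * zorder (\<lambda>z. f z + g z) z)
      = (\<Sum>z\<in>{z \<in> ball c (r + 1). f z = 0}. winding_number \<gamma> z * zorder f z)"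
  proof (rule Rouche_theorem)
    show "\<forall>z. z \<notin> ball c (r + 1) \<longrightarrow> winding_number \<gamma> z = 0" using wn_out by auto
    show "\<forall>z\<in>path_image \<gamma>. cmod (g z) < cmod (f z)"
      using \<open>r > 0\<close> less by (auto simp: \<gamma>_def dist_norm norm_minus_commute)
    show "path_image \<gamma> \<subseteq> ball c (r + 1)"
      using \<open>r > 0\<close> by (auto simp: \<gamma>_def)
  qed (use fin'[OF f f_nz] fin'[OF fg fg_nz] f g in \<open>auto simp: \<gamma>_def intro: holomorphic_on_subset\<close>)
  then have "(of_int (\<Sum>z | z \<in> ball c r \<and> f z + g z = 0. zorder (\<lambda>z. f z + g z) z) :: complex)
       = of_int (\<Sum>z | z \<in> ball c r \<and> f z = 0. zorder f z)"
    by (simp only: reduce[OF fin'[OF f f_nz] f_nz] reduce[OF fin'[OF fg fg_nz] fg_nz])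
  then show "(\<Sum>z | z \<in> ball c r \<and> f z + g z = 0. zorder (\<lambda>z. f z + g z) z)
       = (\<Sum>z | z \<in> ball c r \<and> f z = 0. zorder f z)"
    by (simp only: of_int_eq_iff)
  show "finite {z \<in> ball c r. f z + g z = 0}"
    by (rule finite_subset[OF _ fin[OF fg fg_nz]]) auto
qed

text \<open>
  A common form of \<^const>\<open>disc1\<close> and \<^const>\<open>disc2\<close>: if \<open>2 c\<^sup>2 = m \<pi> \<noteq> 0\<close>, then \<^term>\<open>U_set m\<close> has two components, around
  \<open>c\<close> and \<open>- c\<close>, separated by the line orthogonal to \<open>c\<close>.
\<close>

definition half_U_set :: "int \<Rightarrow> complex \<Rightarrow> complex set" where
  "half_U_set m c = {z \<in> U_set m. Re (z * cnj c) > 0}"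

lemma norm_add_ge_of_Re_pos:
  assumes "Re (z * cnj c) > 0"
  shows "cmod c \<le> cmod (z + c)"
proof (rule power2_le_imp_le)
  have "(cmod (z + c))\<^sup>2 = (cmod z)\<^sup>2 + (cmod c)\<^sup>2 + 2 * Re (z * cnj c)"
    unfolding cmod_power2 by (simp add: power2_eq_square algebra_simps)
  then show "(cmod c)\<^sup>2 \<le> (cmod (z + c))\<^sup>2" using assms by simp
qed simp

text \<open>
  What the asymptotics provides for an entire function \<open>F\<close>, together with the condition that the
  circle bounding \<^term>\<open>B_disc N\<close> lies in the region where it is known.
\<close>

locale sine_perturbation =
  fixes F :: "complex \<Rightarrow> complex" and \<Lambda> :: real and N :: nat
  assumes hol: "F holomorphic_on UNIV"
    and close: "\<And>z. \<Lambda> \<le> cmod z \<Longrightarrow> away_from_pi_multiples (2 * z\<^sup>2)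
                  \<Longrightarrow> cmod (F z - free_chi z) < cmod (free_chi z)"
    and N: "\<Lambda>\<^sup>2 \<le> (real N + 1 / 4) * pi / 2"
begin

lemma nonzero: "\<Lambda> \<le> cmod z \<Longrightarrow> away_from_pi_multiples (2 * z\<^sup>2) \<Longrightarrow> F z \<noteq> 0"
  using close[of z] by auto

lemma count_in_ball:
  assumes "r > 0" and "\<And>z. cmod (z - c) = r \<Longrightarrow> \<Lambda> \<le> cmod z \<and> away_from_pi_multiples (2 * z\<^sup>2)"
  shows "finite {z \<in> ball c r. F z = 0}"
    and "(\<Sum>z | z \<in> ball c r \<and> F z = 0. zorder F z)
       = (\<Sum>z | z \<in> ball c r \<and> free_chi z = 0. zorder free_chi z)"
proof -
  have *: "(\<lambda>z. F z - free_chi z) holomorphic_on UNIV"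
    by (intro holomorphic_intros hol holomorphic_free_chi)
  have "\<And>z. cmod (z - c) = r \<Longrightarrow> cmod (F z - free_chi z) < cmod (free_chi z)"
    using close assms by blast
  from Rouche_ball[OF holomorphic_free_chi * \<open>r > 0\<close> this]
  show "finite {z \<in> ball c r. F z = 0}"
    and "(\<Sum>z | z \<in> ball c r \<and> F z = 0. zorder F z)
       = (\<Sum>z | z \<in> ball c r \<and> free_chi z = 0. zorder free_chi z)"
    by simp_all
qed

lemma norm_ge_of_U_set:
  assumes "z \<in> U_set m" "\<bar>m\<bar> > int N"
  shows "\<Lambda> \<le> cmod z"
proof -
  have "\<bar>of_int m * pi\<bar> - 2 * (cmod z)\<^sup>2 \<le> cmod (of_real (of_int m * pi) - 2 * z\<^sup>2)"
    using norm_triangle_ineq2[of "of_real (of_int m * pi)" "2 * z\<^sup>2"]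
    by (simp only: norm_of_real norm_mult norm_power) simp
  also have "\<dots> < pi / 4" using assms(1) by (simp add: U_set_def norm_minus_commute)
  finally have "\<bar>of_int m\<bar> * pi - pi / 4 < 2 * (cmod z)\<^sup>2" by (simp add: abs_mult)
  moreover have "(real N + 1) * pi \<le> \<bar>of_int m\<bar> * pi"
    using assms(2) by (intro mult_right_mono) (linarith, simp)
  moreover have "(real N + 1) * pi = (real N + 1 / 4) * pi + 3 / 4 * pi" by (simp add: algebra_simps)
  ultimately have "(real N + 1 / 4) * pi / 2 \<le> (cmod z)\<^sup>2"
    using pi_gt_zero by linarith
  then have "\<Lambda>\<^sup>2 \<le> (cmod z)\<^sup>2" using N by linarith
  then show ?thesis by (rule power2_le_imp_le) simp
qed

text \<open>
  Since \<open>2 z\<^sup>2 - m \<pi> = 2 (z - c) (z + c)\<close> and \<open>\<bar>c\<bar> \<le> \<bar>z + c\<bar>\<close> on the half-plane of \<open>c\<close>, the points with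
  \<open>\<bar>2 z\<^sup>2 - m \<pi>\<bar> < 1/4\<close> in this half-plane belong to the ball of radius \<open>1 / (8 \<bar>c\<bar>)\<close> about \<open>c\<close>, and
  this ball is contained in the set in question. Hence all roots there lie in
  the ball, where they are counted by comparison with the double root of \<^const>\<open>free_chi\<close> at \<open>c\<close>.
\<close>

lemma root_count_half_U_set:
  assumes c: "2 * c\<^sup>2 = of_real (of_int m * pi)" and m: "\<bar>m\<bar> > int N"
  shows "has_root_count F (half_U_set m c) 2"
proof -
  have "2 * (cmod c)\<^sup>2 = \<bar>of_int m * pi\<bar>"
    using arg_cong[OF c, of cmod] by (simp only: norm_of_real norm_mult norm_power) simp
  moreover have "1 * 3 \<le> \<bar>of_int m :: real\<bar> * pi" 
    using m pi_gt3 by (intro mult_mono) linarith+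
  ultimately have "1\<^sup>2 \<le> (cmod c)\<^sup>2" by (simp add: abs_mult)
  then have c1: "1 \<le> cmod c" by (rule power2_le_imp_le) simp
  \<comment> \<open>By the factorisation of \<open>2 z\<^sup>2 - m \<pi>\<close>, this radius corresponds to distance at least 1/4.\<close>
  define r where "r = 1 / (8 * cmod c)"
  have r: "r > 0" "r * cmod c = 1 / 8" using c1 by (auto simp: r_def)
  have "r \<le> r * cmod c" using c1 r by simp
  then have r8: "r \<le> 1 / 8" using r by simp
  have factor: "cmod (2 * z\<^sup>2 - of_real (of_int m * pi)) = 2 * (cmod (z - c) * cmod (z + c))" for z
    unfolding c[symmetric] norm_mult[symmetric]
    by (subst norm_mult_numeral1[symmetric]) (simp add: power2_eq_square algebra_simps)
  have inside: "z \<in> half_U_set m c" if z: "cmod (z - c) \<le> r" for z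
  proof -
    have "cmod (z + c) \<le> 2 * cmod c + r"
      using norm_triangle_ineq[of "z - c" "2 * c"] z by (simp add: norm_mult add.commute)
    then have "cmod (z - c) * cmod (z + c) \<le> r * (2 * cmod c + r)"
      using z r by (intro mult_mono) auto
    also have "\<dots> = 2 * (r * cmod c) + r * r" by (simp add: algebra_simps)
    also have "\<dots> \<le> 2 * (1/8) + 1/8 * (1/8)" unfolding r(2) using r8 r by (intro add_mono mult_mono) auto
    finally have close: "2 * (cmod (z - c) * cmod (z + c)) < pi / 4" using pi_gt3 by simp
    have "\<bar>Re ((z - c) * cnj c)\<bar> \<le> r * cmod c"
      using z by (intro order_trans[OF abs_Re_le_cmod]) (auto simp: norm_mult intro: mult_right_mono)
    moreover have "Re ((z - c) * cnj c) = Re (z * cnj c) - Re (c * cnj c)" by (simp add: algebra_simps)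
    ultimately have "Re (z * cnj c) \<ge> Re (c * cnj c) - 1/8" unfolding r(2) by linarith
    moreover have "Re (c * cnj c) \<ge> 1"
      using \<open>1\<^sup>2 \<le> (cmod c)\<^sup>2\<close> by (simp add: complex_mult_cnj cmod_power2)
    ultimately show ?thesis
      using close unfolding half_U_set_def U_set_def mem_Collect_eq factor by simp
  qed
  have away: "\<Lambda> \<le> cmod z \<and> away_from_pi_multiples (2 * z\<^sup>2)"
    if z: "z \<in> half_U_set m c" "r \<le> cmod (z - c)" for z
  proof -
    have "r * cmod c \<le> cmod (z - c) * cmod (z + c)"
      using z r norm_add_ge_of_Re_pos[of z c] by (intro mult_mono) (auto simp: half_U_set_def)
    then have "1/4 \<le> cmod (2 * z\<^sup>2 - of_real (of_int m * pi))" unfolding factor r(2) by simp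
    moreover have "cmod (2 * z\<^sup>2 - of_real (of_int m * pi)) < pi / 4"
      using z by (simp add: half_U_set_def U_set_def)
    ultimately have "away_from_pi_multiples (2 * z\<^sup>2)"
      using pi_gt3 by (intro away_from_pi_multiplesI) auto
    then show ?thesis using norm_ge_of_U_set[OF _ m] z by (auto simp: half_U_set_def)
  qed
  have zeros: "{z \<in> half_U_set m c. F z = 0} = {z \<in> ball c r. F z = 0}"
  proof (intro equalityI subsetI)
    fix z assume "z \<in> {z \<in> half_U_set m c. F z = 0}"
    then show "z \<in> {z \<in> ball c r. F z = 0}"
      using away[of z] nonzero[of z] by (auto simp: dist_norm norm_minus_commute not_less[symmetric])
  qed (use inside in \<open>auto simp: dist_norm norm_minus_commute\<close>)
  have zeros_free: "{z \<in> ball c r. free_chi z = 0} = {c}"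
  proof (intro equalityI subsetI)
    fix z assume z: "z \<in> {z \<in> ball c r. free_chi z = 0}"
    then have zU: "z \<in> half_U_set m c" using inside by (auto simp: dist_norm norm_minus_commute)
    obtain k :: int where k: "2 * z\<^sup>2 = of_real (of_int k * pi)"
      using z free_chi_eq_0_iff by auto
    have "\<not> away_from_pi_multiples (2 * z\<^sup>2)"
      unfolding away_from_pi_multiples_def k by (auto intro!: exI[of _ k])
    then have "\<not> 1/4 \<le> cmod (2 * z\<^sup>2 - of_real (of_int m * pi))"
      using away_from_pi_multiplesI[of "2 * z\<^sup>2" m] zU pi_gt3 by (auto simp: half_U_set_def U_set_def)
    then have "cmod (of_real ((of_int k - of_int m) * pi)) < 1/4"
      unfolding k by (simp add: algebra_simps)
    then have "\<bar>of_int k - of_int m\<bar> * pi < 1 / 4" unfolding norm_of_real abs_mult by simp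
    then have "\<bar>of_int k - of_int m\<bar> * pi < 1 * pi" using pi_gt3 by linarith
    then have "k = m" using pi_gt_zero by (subst (asm) mult_less_cancel_right) auto
    then have "2 * z\<^sup>2 = 2 * c\<^sup>2" using k c by simp
    then have "z\<^sup>2 = c\<^sup>2" by simp
    then have "(z - c) * (z + c) = 0" by (simp add: power2_eq_square algebra_simps)
    moreover have "z + c \<noteq> 0" using norm_add_ge_of_Re_pos[of z c] zU c1 by (auto simp: half_U_set_def)
    ultimately show "z \<in> {c}" by simp
  next
    fix z assume "z \<in> {c}"
    then show "z \<in> {z \<in> ball c r. free_chi z = 0}" using r c free_chi_eq_0_iff by auto
  qed
  have sphere: "\<Lambda> \<le> cmod z \<and> away_from_pi_multiples (2 * z\<^sup>2)" if "cmod (z - c) = r" for z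
    using away[of z] inside[of z] that by simp
  have "free_chi c = 0" "c \<noteq> 0" using c c1 free_chi_eq_0_iff by auto
  then have "(\<Sum>z | z \<in> half_U_set m c \<and> F z = 0. zorder F z) = 2"
    using count_in_ball(2)[OF r(1), of c, OF sphere]
    unfolding zeros zeros_free by (simp add: zorder_free_chi_nonzero)
  then show ?thesis
    unfolding has_root_count_def using count_in_ball(1)[OF r(1), of c, OF sphere] unfolding zeros by simp
qed


text \<open>
  On the boundary circle \<open>\<bar>2 z\<^sup>2\<bar> = (N + 1/4) \<pi>\<close> has distance at least \<open>\<pi>/4\<close> from all \<open>\<bar>m\<bar> \<pi>\<close>. Inside, the
  unperturbed function has the fourfold root 0 and, for each of the \<open>2 N\<close> nonzero integers \<open>m\<close>
  with \<open>\<bar>m\<bar> \<le> N\<close>, two double roots.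
\<close>

lemma root_count_B_disc: "has_root_count F (B_disc N) (4 * (2 * N + 1))"
proof -
  define \<rho> where "\<rho> = sqrt ((real N + 1 / 4) * pi / 2)"
  have \<rho>: "\<rho> > 0" "\<rho>\<^sup>2 = (real N + 1 / 4) * pi / 2"
    unfolding \<rho>_def by simp_all
  have ball: "B_disc N = ball 0 \<rho>"
    unfolding B_disc_def \<rho>_def[symmetric] by (simp add: ball_def)
  have sphere: "\<Lambda> \<le> cmod z \<and> away_from_pi_multiples (2 * z\<^sup>2)" if "cmod (z - 0) = \<rho>" for z
  proof
    have z: "cmod z = \<rho>" using that by simp
    have "\<Lambda>\<^sup>2 \<le> (cmod z)\<^sup>2" unfolding z \<rho>(2) by (rule N)
    then show "\<Lambda> \<le> cmod z" by (rule power2_le_imp_le) simp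
    show "away_from_pi_multiples (2 * z\<^sup>2)"
      unfolding away_from_pi_multiples_def
    proof
      fix m :: int
      have "2 * (cmod z)\<^sup>2 = (real N + 1 / 4) * pi" unfolding z \<rho>(2) by simp
      then have "\<bar>cmod (2 * z\<^sup>2) - cmod (of_real (of_int m * pi))\<bar> = \<bar>(real N + 1/4) * pi - \<bar>of_int m\<bar> * pi\<bar>"
        by (simp only: norm_of_real norm_mult norm_power abs_mult) simp
      also have "\<dots> = \<bar>real N + 1/4 - \<bar>of_int m\<bar>\<bar> * pi" by (simp add: left_diff_distrib[symmetric] abs_mult)
      finally have "\<bar>real N + 1/4 - \<bar>of_int m\<bar>\<bar> * pi \<le> cmod (2 * z\<^sup>2 - of_real (of_int m * pi))"
        using norm_triangle_ineq3[of "2 * z\<^sup>2" "of_real (of_int m * pi)"] by linarith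
      moreover have "\<bar>m\<bar> \<le> int N \<or> int N + 1 \<le> \<bar>m\<bar>" by linarith
      then have "real_of_int \<bar>m\<bar> \<le> real_of_int (int N) \<or> real_of_int (int N + 1) \<le> real_of_int \<bar>m\<bar>"
        by (simp only: of_int_le_iff)
      then have "1/4 \<le> \<bar>real N + 1/4 - \<bar>of_int m\<bar>\<bar>" by auto
      then have "1/4 * 1 \<le> \<bar>real N + 1/4 - \<bar>of_int m\<bar>\<bar> * pi" using pi_gt3 by (intro mult_mono) auto
      ultimately show "1 / 4 \<le> cmod (2 * z\<^sup>2 - of_real (of_int m * pi))" by simp
    qed
  qed
  define M where "M = {-int N..int N} - {0}"
  define R where "R = (\<lambda>m::int. {z::complex. 2 * z\<^sup>2 = of_real (of_int m * pi)})"
  have card_R: "finite (R m) \<and> card (R m) = 2" if "m \<in> M" for m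
  proof -
    define s where "s = csqrt (of_real (of_int m * pi / 2))"
    have s: "2 * s\<^sup>2 = of_real (of_int m * pi)" unfolding s_def power2_csqrt by simp
    have "s \<noteq> 0" using s that by (auto simp: M_def)
    have "R m = {s, -s}"
    proof (intro equalityI subsetI)
      fix z assume "z \<in> R m"
      then have "2 * z\<^sup>2 = 2 * s\<^sup>2" unfolding s by (simp add: R_def)
      then have "z\<^sup>2 = s\<^sup>2" by simp
      then show "z \<in> {s, -s}" by (simp add: power2_eq_iff)
    qed (use s in \<open>auto simp: R_def\<close>)
    then show ?thesis using \<open>s \<noteq> 0\<close> by auto
  qed
  have "0 \<in> {-int N..int N}" by simp
  then have card_M: "card M = 2 * N" by (simp add: M_def card_Diff_singleton)
  have card_UN: "card (\<Union>m\<in>M. R m) = 4 * N"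
    using card_R card_M by (subst card_UN_disjoint) (auto simp: M_def R_def)
  have fin_UN: "finite (\<Union>m\<in>M. R m)" using card_R by (auto simp: M_def)
  have root_in_ball: "z \<in> ball 0 \<rho> \<longleftrightarrow> \<bar>m\<bar> \<le> int N" if "z \<in> R m" for m z
  proof -
    have "cmod (2 * z\<^sup>2) = cmod (of_real (of_int m * pi))" using that by (simp add: R_def)
    then have "2 * (cmod z)\<^sup>2 = \<bar>of_int m\<bar> * pi"
      by (simp only: norm_of_real norm_mult norm_power abs_mult) simp
    moreover have "cmod z < \<rho> \<longleftrightarrow> 2 * (cmod z)\<^sup>2 < 2 * \<rho>\<^sup>2"
      using power_mono_iff[of \<rho> "cmod z" 2] \<rho>(1) by (simp add: linorder_not_le[symmetric])
    moreover have "2 * \<rho>\<^sup>2 = (real N + 1/4) * pi" unfolding \<rho>(2) by simp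
    ultimately have "cmod z < \<rho> \<longleftrightarrow> \<bar>of_int m\<bar> * pi < (real N + 1/4) * pi" by simp
    also have "\<dots> \<longleftrightarrow> \<bar>of_int m\<bar> < real N + 1/4" by simp
    also have "\<dots> \<longleftrightarrow> \<bar>m\<bar> \<le> int N" by linarith
    finally show ?thesis by simp
  qed
  have Z: "{z \<in> ball 0 \<rho>. free_chi z = 0} = insert 0 (\<Union>m\<in>M. R m)"
  proof (intro equalityI subsetI)
    fix z assume z: "z \<in> {z \<in> ball 0 \<rho>. free_chi z = 0}"
    then have "free_chi z = 0" by simp
    then obtain m where m: "z \<in> R m" unfolding R_def free_chi_eq_0_iff by blast
    show "z \<in> insert 0 (\<Union>m\<in>M. R m)"
    proof (cases "m = 0")
      case True
      then show ?thesis using m by (simp add: R_def)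
    next
      case False
      then have "m \<in> M" using root_in_ball[OF m] z by (auto simp: M_def)
      then show ?thesis using m by blast
    qed
  next
    fix z assume z: "z \<in> insert 0 (\<Union>m\<in>M. R m)"
    have "0 \<in> R 0" by (simp add: R_def)
    then have "z \<in> (\<Union>m\<in>insert 0 M. R m)" using z by blast
    then obtain m where "z \<in> R m" "m \<in> insert 0 M" by blast
    then have m: "z \<in> R m" "\<bar>m\<bar> \<le> int N" by (auto simp: M_def)
    have "free_chi z = 0" using m(1) unfolding free_chi_eq_0_iff R_def by blast
    then show "z \<in> {z \<in> ball 0 \<rho>. free_chi z = 0}"
      using root_in_ball[OF m(1)] m(2) by simp
  qed
  have not0: "0 \<notin> (\<Union>m\<in>M. R m)" by (auto simp: R_def M_def)
  have "zorder free_chi z = 2" if "z \<in> (\<Union>m\<in>M. R m)" for z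
    using that not0 Z by (intro zorder_free_chi_nonzero) auto
  then have "(\<Sum>z | z \<in> ball 0 \<rho> \<and> free_chi z = 0. zorder free_chi z) = int (4 * (2 * N + 1))"
    unfolding Z using fin_UN not0 card_UN by (simp add: zorder_free_chi_0)
  with count_in_ball(2)[OF \<rho>(1), of 0, OF sphere]
  have "(\<Sum>z | z \<in> ball 0 \<rho> \<and> F z = 0. zorder F z) = int (4 * (2 * N + 1))" by (rule trans)
  with count_in_ball(1)[OF \<rho>(1), of 0, OF sphere] show ?thesis
    unfolding has_root_count_def ball by (rule conjI)
qed

lemma root_location:
  assumes "F z = 0" "z \<notin> B_disc N"
  obtains m where "\<bar>m\<bar> > int N" "z \<in> U_set m"
proof -
  have "(real N + 1 / 4) * pi / 2 \<le> (cmod z)\<^sup>2"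
    using assms(2) unfolding B_disc_def mem_Collect_eq not_less by (rule sqrt_le_D)
  with N have "\<Lambda>\<^sup>2 \<le> (cmod z)\<^sup>2" by (rule order_trans)
  then have "\<Lambda> \<le> cmod z" by (rule power2_le_imp_le) simp
  then have "\<not> away_from_pi_multiples (2 * z\<^sup>2)" using nonzero[of z] assms by auto
  then obtain m :: int where m: "cmod (2 * z\<^sup>2 - of_real (of_int m * pi)) < 1 / 4"
    by (auto simp: away_from_pi_multiples_def not_le)
  have "cmod (2 * z\<^sup>2) \<le> cmod (of_real (of_int m * pi)) + cmod (2 * z\<^sup>2 - of_real (of_int m * pi))"
    by (rule norm_triangle_sub)
  also have "cmod (2 * z\<^sup>2) = 2 * (cmod z)\<^sup>2" by (simp add: norm_mult norm_power)
  also have "cmod (of_real (of_int m * pi)) = \<bar>of_int m\<bar> * pi" by (simp only: norm_of_real abs_mult) simp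
  finally have "(real N + 1/4) * pi < \<bar>of_int m\<bar> * pi + 1/4 * pi"
    using m \<open>(real N + 1 / 4) * pi / 2 \<le> (cmod z)\<^sup>2\<close> pi_gt3 by simp
  then have "real N * pi < \<bar>of_int m\<bar> * pi" by (simp add: algebra_simps)
  then have "int N < \<bar>m\<bar>" by (subst (asm) mult_less_cancel_right) auto
  moreover have "z \<in> U_set m" using m pi_gt3 by (simp add: U_set_def)
  ultimately show ?thesis using that by blast
qed

end

lemma disc1_eq_half_U_set:
  assumes "n \<noteq> 0"
  obtains c where "2 * c\<^sup>2 = of_real (of_int \<bar>n\<bar> * pi)" "disc1 n = half_U_set \<bar>n\<bar> c"
proof
  define s where "s = sqrt (of_int \<bar>n\<bar> * pi / 2)"
  have s: "s > 0" "2 * s\<^sup>2 = of_int \<bar>n\<bar> * pi" using assms by (auto simp: s_def)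
  define c where "c = complex_of_real (if n > 0 then s else -s)"
  show "2 * c\<^sup>2 = of_real (of_int \<bar>n\<bar> * pi)"
    unfolding s(2)[symmetric] by (simp add: c_def)
  show "disc1 n = half_U_set \<bar>n\<bar> c"
    using s by (auto simp: disc1_def half_U_set_def c_def zero_less_mult_iff mult_less_0_iff)
qed

lemma disc2_eq_half_U_set:
  assumes "n \<noteq> 0"
  obtains c where "2 * c\<^sup>2 = of_real (of_int (- \<bar>n\<bar>) * pi)" "disc2 n = half_U_set (- \<bar>n\<bar>) c"
proof
  define s where "s = sqrt (of_int \<bar>n\<bar> * pi / 2)"
  have s: "s > 0" "2 * s\<^sup>2 = of_int \<bar>n\<bar> * pi" using assms by (auto simp: s_def)
  define c where "c = \<i> * complex_of_real (if n > 0 then s else -s)"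
  have "2 * c\<^sup>2 = - of_real (2 * s\<^sup>2)" by (simp add: c_def power_mult_distrib)
  then show "2 * c\<^sup>2 = of_real (of_int (- \<bar>n\<bar>) * pi)" unfolding s(2) by simp
  show "disc2 n = half_U_set (- \<bar>n\<bar>) c"
    using s by (auto simp: disc2_def half_U_set_def c_def zero_less_mult_iff mult_less_0_iff)
qed

text \<open>
  For \<open>m > 0\<close> the set avoids the imaginary axis, where \<open>z\<^sup>2 \<le> 0\<close>; for \<open>m < 0\<close> it avoids the real
  axis.
\<close>

lemma U_set_subset_discs:
  assumes "z \<in> U_set m" "m \<noteq> 0"
  shows "z \<in> disc1 m \<union> disc1 (-m) \<union> disc2 m \<union> disc2 (-m)"
proof -
  have "\<bar>Re (2 * z\<^sup>2 - of_real (of_int m * pi))\<bar> < pi / 4"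
    using assms abs_Re_le_cmod[of "2 * z\<^sup>2 - of_real (of_int m * pi)"] by (simp add: U_set_def)
  then have close: "\<bar>2 * ((Re z)\<^sup>2 - (Im z)\<^sup>2) - of_int m * pi\<bar> < pi / 4"
    by (simp add: Re_power2)
  show ?thesis
  proof (cases "m > 0")
    case True
    then have *: "1 * pi \<le> of_int m * pi" by (intro mult_right_mono) auto
    have "Re z \<noteq> 0"
    proof
      assume "Re z = 0"
      then have "\<bar>- (2 * (Im z)\<^sup>2) - of_int m * pi\<bar> < pi / 4" using close by simp
      moreover have "0 \<le> 2 * (Im z)\<^sup>2" by simp
      ultimately show False using * pi_gt_zero by linarith
    qed
    then show ?thesis using assms True by (auto simp: disc1_def)
  next
    case False
    then have *: "of_int m * pi \<le> (-1) * pi" using assms(2) by (intro mult_right_mono) auto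
    have "Im z \<noteq> 0"
    proof
      assume "Im z = 0"
      then have "\<bar>2 * (Re z)\<^sup>2 - of_int m * pi\<bar> < pi / 4" using close by simp
      moreover have "0 \<le> 2 * (Re z)\<^sup>2" by simp
      ultimately show False using * pi_gt_zero by linarith
    qed
    then show ?thesis using assms False by (auto simp: disc2_def)
  qed
qed

lemma root_localisation:
  assumes "F holomorphic_on UNIV"
    and "\<And>z. \<Lambda> \<le> cmod z \<Longrightarrow> away_from_pi_multiples (2 * z\<^sup>2)
              \<Longrightarrow> cmod (F z - free_chi z) < cmod (free_chi z)"
    and "\<Lambda>\<^sup>2 \<le> (real N + 1 / 4) * pi / 2"
  shows "(\<forall>n::int. \<bar>n\<bar> > int N \<longrightarrow> has_root_count F (disc1 n) 2 \<and> has_root_count F (disc2 n) 2) \<and>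
         has_root_count F (B_disc N) (4 * (2 * N + 1)) \<and>
         {z. F z = 0} \<subseteq> B_disc N \<union> (\<Union>n\<in>{n::int. \<bar>n\<bar> > int N}. disc1 n \<union> disc2 n)"
proof -
  interpret sine_perturbation F \<Lambda> N by unfold_locales (use assms in auto)
  have "has_root_count F (disc1 n) 2 \<and> has_root_count F (disc2 n) 2" if n: "\<bar>n\<bar> > int N" for n
  proof -
    have "n \<noteq> 0" using n by auto
    obtain c where c: "2 * c\<^sup>2 = of_real (of_int \<bar>n\<bar> * pi)" "disc1 n = half_U_set \<bar>n\<bar> c"
      by (rule disc1_eq_half_U_set[OF \<open>n \<noteq> 0\<close>])
    obtain d where d: "2 * d\<^sup>2 = of_real (of_int (- \<bar>n\<bar>) * pi)" "disc2 n = half_U_set (- \<bar>n\<bar>) d"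
      by (rule disc2_eq_half_U_set[OF \<open>n \<noteq> 0\<close>])
    show ?thesis unfolding c(2) d(2) using n by (intro conjI root_count_half_U_set c d) auto
  qed
  moreover have "z \<in> B_disc N \<union> (\<Union>n\<in>{n::int. \<bar>n\<bar> > int N}. disc1 n \<union> disc2 n)" if "F z = 0" for z
  proof (cases "z \<in> B_disc N")
    case False
    then obtain m where m: "\<bar>m\<bar> > int N" "z \<in> U_set m" using root_location \<open>F z = 0\<close> by blast
    then have "m \<noteq> 0" by auto
    from U_set_subset_discs[OF m(2) this] consider "z \<in> disc1 m \<union> disc2 m" | "z \<in> disc1 (-m) \<union> disc2 (-m)"
      by blast
    then show ?thesis
    proof cases
      case 1
      then show ?thesis using m(1) by blast
    next
      case 2
      moreover have "\<bar>-m\<bar> > int N" using m(1) by simp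
      ultimately show ?thesis by blast
    qed
  qed simp
  ultimately show ?thesis using root_count_B_disc by blast
qed

section \<open>Uniform localisation of the roots\<close>

text \<open>
  The difference factors as \<open>(\<Delta> - 2 cos w) (\<Delta> + 2 cos w)\<close> with \<open>w = 2 z\<^sup>2\<close>. The first factor is
  small relative to \<open>exp \<bar>Im w\<bar>\<close>, the second at most \<open>5 exp \<bar>Im w\<bar>\<close>; the lower bound for the sine wins
  because \<open>5 c\<^sup>2 / 2 < 4 c\<^sup>2\<close>.
\<close>

lemma chi_P_close_to_free_chi:
  assumes sin: "c * exp \<bar>Im (2 * z\<^sup>2)\<bar> \<le> cmod (sin (2 * z\<^sup>2))" and c: "0 < c"
    and \<Delta>: "cmod (discriminant z \<psi> - 2 * cos (2 * z\<^sup>2)) \<le> \<eta> * exp \<bar>Im (2 * z\<^sup>2)\<bar>"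
    and \<eta>: "\<eta> \<le> 1" "\<eta> \<le> c\<^sup>2 / 2"
  shows "cmod (chi_P z \<psi> - free_chi z) < cmod (free_chi z)"
proof -
  define w where "w = 2 * z\<^sup>2"
  define y where "y = exp \<bar>Im w\<bar>"
  have y0: "0 < y" by (simp add: y_def)
  have "cmod (cos w) \<le> y"
  proof -
    have "cmod (cos w) = cmod (exp (\<i> * w) + exp (- (\<i> * w))) / 2" by (simp add: cos_exp_eq norm_divide)
    also have "\<dots> \<le> (cmod (exp (\<i> * w)) + cmod (exp (- (\<i> * w)))) / 2"
      by (intro divide_right_mono norm_triangle_ineq) auto
    also have "\<dots> \<le> (y + y) / 2"
      by (intro divide_right_mono add_mono) (auto simp: y_def)
    finally show ?thesis by simp
  qed
  moreover have "discriminant z \<psi> + 2 * cos w = (discriminant z \<psi> - 2 * cos w) + 4 * cos w" by simp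
  then have "cmod (discriminant z \<psi> + 2 * cos w) \<le> cmod (discriminant z \<psi> - 2 * cos w) + 4 * cmod (cos w)"
    using norm_triangle_ineq[of "discriminant z \<psi> - 2 * cos w" "4 * cos w"] by (simp add: norm_mult add.commute)
  moreover have "\<eta> * y \<le> 1 * y" using \<eta>(1) y0 by (intro mult_right_mono) auto
  ultimately have sum: "cmod (discriminant z \<psi> + 2 * cos w) \<le> 5 * y"
    using \<Delta> unfolding w_def[symmetric] y_def[symmetric] by linarith
  have "chi_P z \<psi> - free_chi z = (discriminant z \<psi>)\<^sup>2 - 4 * (1 - (sin w)\<^sup>2)"
    by (simp add: chi_P_def free_chi_def w_def)
  also have "1 - (sin w)\<^sup>2 = (cos w)\<^sup>2" using sin_cos_squared_add[of w] by (simp add: algebra_simps)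
  also have "(discriminant z \<psi>)\<^sup>2 - 4 * (cos w)\<^sup>2 = (discriminant z \<psi> - 2 * cos w) * (discriminant z \<psi> + 2 * cos w)"
    by (simp add: power2_eq_square algebra_simps)
  finally have "cmod (chi_P z \<psi> - free_chi z)
      = cmod (discriminant z \<psi> - 2 * cos w) * cmod (discriminant z \<psi> + 2 * cos w)" by (simp add: norm_mult)
  also have "\<dots> \<le> (c\<^sup>2 / 2 * y) * (5 * y)"
  proof (rule mult_mono)
    have "\<eta> * y \<le> c\<^sup>2 / 2 * y" using \<eta>(2) y0 by (intro mult_right_mono) auto
    then show "cmod (discriminant z \<psi> - 2 * cos w) \<le> c\<^sup>2 / 2 * y"
      using \<Delta> unfolding w_def[symmetric] y_def[symmetric] by linarith
  qed (use sum y0 in auto)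
  also have "\<dots> < 4 * (c * y)\<^sup>2" using c y0 by (simp add: power2_eq_square)
  also have "\<dots> \<le> 4 * (cmod (sin w))\<^sup>2"
    using sin c y0 unfolding w_def[symmetric] y_def[symmetric] by (intro mult_left_mono power_mono) auto
  also have "\<dots> = cmod (free_chi z)" by (simp add: free_chi_def w_def norm_mult norm_power)
  finally show ?thesis .
qed

text \<open>
  The sum of the variation majorants of the components is a common one for all four.
\<close>

lemma X_space_bounds:
  fixes \<psi> :: "(real \<Rightarrow> complex) ^ 4"
  assumes "\<psi> \<in> X_space" and "X_norm \<psi> \<le> R"
  obtains G where "\<And>j. continuous_on UNIV (\<psi> $ j)" "\<And>j. variation_majorant (\<psi> $ j) G"
    "G 1 - G 0 \<le> 4 * (1 + R\<^sup>2)" "\<And>j t. t \<in> {0..1} \<Longrightarrow> cmod ((\<psi> $ j) t) \<le> 4 * (1 + R\<^sup>2)"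
proof -
  have "\<exists>G. continuous_on UNIV (\<psi> $ j) \<and> variation_majorant (\<psi> $ j) G \<and> G 0 = 0 \<and> G 1 \<le> 1 + R\<^sup>2 \<and>
      (\<forall>t\<in>{0..1}. cmod ((\<psi> $ j) t) \<le> 1 + R\<^sup>2)" for j
  proof -
    have "(H1_norm (\<psi> $ j))\<^sup>2 \<le> (\<Sum>j\<in>UNIV. (H1_norm (\<psi> $ j))\<^sup>2)" by (intro member_le_sum) auto
    then have "\<bar>H1_norm (\<psi> $ j)\<bar> \<le> X_norm \<psi>" unfolding X_norm_def by (rule real_le_rsqrt[of "\<bar>_\<bar>", simplified])
    then have "H1_norm (\<psi> $ j) \<le> R" using assms(2) by linarith
    moreover have "\<psi> $ j \<in> H1_circle" using assms(1) by (simp add: X_space_def)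
    ultimately show ?thesis using H1_circle_bounds[of "\<psi> $ j" R] by metis
  qed
  then obtain G where G: "\<And>j. continuous_on UNIV (\<psi> $ j)" "\<And>j. variation_majorant (\<psi> $ j) (G j)"
    "\<And>j. G j 0 = 0" "\<And>j. G j 1 \<le> 1 + R\<^sup>2" "\<And>j t. t \<in> {0..1} \<Longrightarrow> cmod ((\<psi> $ j) t) \<le> 1 + R\<^sup>2"
    by metis
  show ?thesis
  proof
    show "continuous_on UNIV (\<psi> $ j)" for j by (rule G(1))
    show "variation_majorant (\<psi> $ j) (\<lambda>t. \<Sum>j\<in>UNIV. G j t)" for j
      by (rule variation_majorant_sum[of UNIV j "\<lambda>j. \<psi> $ j"]) (use G in auto)
    have "(\<Sum>j\<in>UNIV. G j 1) \<le> of_nat (card (UNIV :: 4 set)) * (1 + R\<^sup>2)" by (intro sum_bounded_above G)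
    then show "(\<Sum>j\<in>UNIV. G j 1) - (\<Sum>j\<in>UNIV. G j 0) \<le> 4 * (1 + R\<^sup>2)" by (simp add: G(3))
    show "cmod ((\<psi> $ j) t) \<le> 4 * (1 + R\<^sup>2)" if "t \<in> {0..1}" for j t
      using G(5)[OF that, of j] by (rule order_trans) simp
  qed
qed

theorem lemma3p13:
  fixes B :: "((real \<Rightarrow> complex) ^ 4) set"
  assumes "X_bounded B"
  shows "\<exists>N::nat. N \<ge> 1 \<and> (\<forall>\<psi>\<in>B.
           (\<lambda>z. chi_P z \<psi>) holomorphic_on UNIV \<and>
           (\<forall>n::int. \<bar>n\<bar> > int N \<longrightarrow>
              has_root_count (\<lambda>z. chi_P z \<psi>) (disc1 n) 2 \<and>
              has_root_count (\<lambda>z. chi_P z \<psi>) (disc2 n) 2) \<and>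
           has_root_count (\<lambda>z. chi_P z \<psi>) (B_disc N) (4 * (2 * N + 1)) \<and>
           {z. chi_P z \<psi> = 0} \<subseteq> B_disc N \<union> (\<Union>n\<in>{n::int. \<bar>n\<bar> > int N}. disc1 n \<union> disc2 n))"
proof -
  obtain R\<^sub>0 where B: "B \<subseteq> X_space" "\<And>\<psi>. \<psi> \<in> B \<Longrightarrow> X_norm \<psi> \<le> R\<^sub>0"
    using assms by (auto simp: X_bounded_def)
  obtain c where c: "c > 0" "\<And>w. away_from_pi_multiples w \<Longrightarrow> c * exp \<bar>Im w\<bar> \<le> cmod (sin w)"
    using norm_sin_lower_bound by blast
  define R where "R = 4 * (1 + R\<^sub>0\<^sup>2)"
  define K where "K = 114 * R ^ 3 * exp (24 * R ^ 3)"
  define \<eta> where "\<eta> = min 1 (c\<^sup>2 / 2)"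
  \<comment> \<open>Beyond \<open>\<Lambda>\<close> the asymptotics is valid and its relative error \<open>K / \<bar>z\<bar>\<close> is at most \<open>\<eta>\<close>.\<close>
  define \<Lambda> where "\<Lambda> = max (4 * R) (K / \<eta>)"
  define N where "N = nat \<lceil>\<Lambda>\<^sup>2\<rceil> + 1"
  have R: "1 \<le> R" by (simp add: R_def)
  have \<eta>: "\<eta> > 0" "\<eta> \<le> 1" "\<eta> \<le> c\<^sup>2 / 2" using c(1) by (auto simp: \<eta>_def)
  have \<Lambda>: "0 < \<Lambda>" using R by (simp add: \<Lambda>_def)
  have "\<Lambda>\<^sup>2 \<le> real N" unfolding N_def by linarith
  also have "real N * 1 \<le> (real N + 1/4) * (pi / 2)" using pi_gt3 by (intro mult_mono) auto
  finally have N: "N \<ge> 1" "\<Lambda>\<^sup>2 \<le> (real N + 1/4) * pi / 2" by (simp_all add: N_def)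
  show ?thesis
  proof (intro exI[of _ N] conjI[OF N(1)] ballI)
    fix \<psi> assume \<psi>: "\<psi> \<in> B"
    then obtain G where G: "\<And>j. continuous_on UNIV (\<psi> $ j)" "\<And>j. variation_majorant (\<psi> $ j) G"
      "G 1 - G 0 \<le> R" "\<And>j t. t \<in> {0..1} \<Longrightarrow> cmod ((\<psi> $ j) t) \<le> R"
      using X_space_bounds[of \<psi> R\<^sub>0] B unfolding R_def by blast
    have hol: "(\<lambda>z. chi_P z \<psi>) holomorphic_on UNIV"
      unfolding chi_P_def by (intro holomorphic_intros holomorphic_discriminant G)
    have "cmod (chi_P z \<psi> - free_chi z) < cmod (free_chi z)"
      if z: "\<Lambda> \<le> cmod z" "away_from_pi_multiples (2 * z\<^sup>2)" for z
    proof (rule chi_P_close_to_free_chi[OF c(2)[OF z(2)] c(1) _ \<eta>(2,3)])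
      have z': "4 * R \<le> cmod z" "K / \<eta> \<le> cmod z" using z(1) by (auto simp: \<Lambda>_def)
      have "0 < cmod z" using \<Lambda> z(1) by linarith
      then have "K / cmod z \<le> \<eta>" using z'(2) \<eta>(1) by (simp add: field_simps)
      then have "K / cmod z * exp \<bar>Im (2 * z\<^sup>2)\<bar> \<le> \<eta> * exp \<bar>Im (2 * z\<^sup>2)\<bar>" by (intro mult_right_mono) auto
      then show "cmod (discriminant z \<psi> - 2 * cos (2 * z\<^sup>2)) \<le> \<eta> * exp \<bar>Im (2 * z\<^sup>2)\<bar>"
        using discriminant_asymptotics[OF G(1) R z'(1) G(2-4)] unfolding K_def by (rule order_trans[rotated])
    qed
    from root_localisation[OF hol this N(2)] hol
    show "(\<lambda>z. chi_P z \<psi>) holomorphic_on UNIV \<and>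
           (\<forall>n::int. \<bar>n\<bar> > int N \<longrightarrow>
              has_root_count (\<lambda>z. chi_P z \<psi>) (disc1 n) 2 \<and>
              has_root_count (\<lambda>z. chi_P z \<psi>) (disc2 n) 2) \<and>
           has_root_count (\<lambda>z. chi_P z \<psi>) (B_disc N) (4 * (2 * N + 1)) \<and>
           {z. chi_P z \<psi> = 0} \<subseteq> B_disc N \<union> (\<Union>n\<in>{n::int. \<bar>n\<bar> > int N}. disc1 n \<union> disc2 n)"
      by auto
  qed
qed

end
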